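(* Let $G$ be a digraph of order $n$ with dichromatic number $r$. Then: (i) If $r=2$, then $LE(G)\ge 4$ if $n=2$ and $LE(G)\ge n$ if $n\ge 3$. If $n=2$, equality holds if and only if $G$ is the directed cycle $C_2$. If $n\geq 3$, equality holds if and only if $G$ contains a directed cycle $C_{n'}$ with $n'\geq 3$ and every component (if any) of $G-\mathcal V(C_{n'})$ is an in-tree whose root is an inneighbor of exactly one vertex of $C_{n'}$. (ii) If $r\geq 3$, then $$LE(G)\geq n+r^3-r^2-r,$$ with equality if and only if $G$ contains a bidirected complete graph $\overset{\leftrightarrow}{K}_r$ and every component (if any) of $G-\mathcal V(\overset{\leftrightarrow}{K}_r)$ is an in-tree whose root is an inneighbor of exactly one vertex of $\overset{\leftrightarrow}{K}_r$.
   Context: All digraphs are finite, have no loops or multiple arcs, and are weakly connected (standing assumption). For a digraph $G$ with vertex set $\{v_1,\dots,v_n\}$, $d_i^+$ is the outdegree of $v_i$, $A(G)$ the adjacency matrix, $D^+(G)=\mathrm{diag}(d_1^+,\dots,d_n^+)$, and $L(G)=D^+(G)-A(G)$ the Laplacian matrix; $LE(G)=\sum_{i=1}^n\lambda_i^2$ where $\lambda_i$ are the eigenvalues of $L(G)$. A set of vertices is acyclic if it induces a subdigraph with no directed cycle; the dichromatic number of $G$ is the least $r$ such that $\mathcal V(G)$ can be partitioned into $r$ acyclic sets. $C_\ell$ denotes a directed cycle of length $\ell$ ($C_2$ is a pair of opposite arcs). $\overset{\leftrightarrow}{K}_r$ is the complete graph on $r$ vertices with each edge replaced by two opposite arcs.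 An in-tree is a digraph whose underlying undirected graph is a tree and in which every vertex has outdegree at most one; its root is its unique vertex of outdegree $0$ (within the in-tree). A vertex $x$ is an inneighbor of $y$ if $(x,y)$ is an arc. $G-S$ denotes the subdigraph obtained by deleting the vertex set $S$.
   Formalization: In the equality cases for n≥3, C_{n'} (or K_r) is taken to be an induced subdigraph, and the single arc from each in-tree's root is the only arc, in either direction, between that in-tree and the core; read literally, the "if" directions are false. *)

theory Defs
  imports
    "Graph_Theory.Graph_Theory"
    "Graph_Theory.Kuratowski"
    "Jordan_Normal_Form.Char_Poly"
    "HOL-Library.Disjoint_Sets"
begin

(* The matrices are taken with respect to an enumeration vs = [v_1, ..., v_n] of the vertices;
   positions are counted from 0. *)

definition adjacency_mat :: "('a, 'b) pre_digraph \<Rightarrow> 'a list \<Rightarrow> complex mat" where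
  "adjacency_mat G vs =
     mat (length vs) (length vs) (\<lambda>(i, j). if vs ! i \<rightarrow>\<^bsub>G\<^esub> vs ! j then 1 else 0)"

definition outdegree_mat :: "('a, 'b) pre_digraph \<Rightarrow> 'a list \<Rightarrow> complex mat" where
  "outdegree_mat G vs =
     mat (length vs) (length vs) (\<lambda>(i, j). if i = j then of_nat (out_degree G (vs ! i)) else 0)"

definition laplacian_mat :: "('a, 'b) pre_digraph \<Rightarrow> 'a list \<Rightarrow> complex mat" where
  "laplacian_mat G vs = outdegree_mat G vs - adjacency_mat G vs"

(* Each eigenvalue is counted with its algebraic multiplicity, i.e. its multiplicity as a root of
   the characteristic polynomial.  The value is a complex number; inequalities between complex
   numbers are those of HOL-Library.Complex_Order, where x \<le> y means
   Re x \<le> Re y and Im x = Im y, so of_nat k \<le> LE G vs also says that LE G vs is real. *)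
definition LE :: "('a, 'b) pre_digraph \<Rightarrow> 'a list \<Rightarrow> complex" where
  "LE G vs = (\<Sum>x | eigenvalue (laplacian_mat G vs) x.
     of_nat (Polynomial.order x (char_poly (laplacian_mat G vs))) * x\<^sup>2)"

definition acyclic_set :: "('a, 'b) pre_digraph \<Rightarrow> 'a set \<Rightarrow> bool" where
  "acyclic_set G S \<longleftrightarrow> \<not> (\<exists>p. pre_digraph.cycle (G \<restriction> S) p)"

definition dichromatic_number :: "('a, 'b) pre_digraph \<Rightarrow> nat" where
  "dichromatic_number G =
     (LEAST r. \<exists>P. partition_on (verts G) P \<and> card P = r \<and> (\<forall>S\<in>P. acyclic_set G S))"

definition directed_cycle :: "nat \<Rightarrow> ('a, 'b) pre_digraph \<Rightarrow> bool" where
  "directed_cycle l C \<longleftrightarrow> digraph C \<and>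
     (\<exists>p. pre_digraph.cycle C p \<and> length p = l \<and> arcs C = set p \<and> verts C = tail C ` set p)"

(* mk_symmetric T represents the underlying undirected graph of T, an edge being a pair of opposite
   arcs.  Its cycles of length 2 merely run back and forth along one edge, so the cycles of the
   undirected graph are those of length at least 3.  (The library predicate "tree" is different: it
   only excludes directed cycles of T.) *)
definition underlying_tree :: "('a, 'b) pre_digraph \<Rightarrow> bool" where
  "underlying_tree T \<longleftrightarrow> Digraph_Component.connected T \<and>
     \<not> (\<exists>p. pre_digraph.cycle (with_proj (mk_symmetric T)) p \<and> 3 \<le> length p)"

definition in_tree :: "('a, 'b) pre_digraph \<Rightarrow> bool" where
  "in_tree T \<longleftrightarrow> underlying_tree T \<and> (\<forall>v\<in>verts T. out_degree T v \<le> 1)"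

definition in_tree_root :: "('a, 'b) pre_digraph \<Rightarrow> 'a \<Rightarrow> bool" where
  "in_tree_root T x \<longleftrightarrow> {v \<in> verts T. out_degree T v = 0} = {x}"

definition delete_verts :: "('a, 'b) pre_digraph \<Rightarrow> 'a set \<Rightarrow> ('a, 'b) pre_digraph" where
  "delete_verts G S = G \<restriction> (verts G - S)"

definition weak_component :: "('a, 'b) pre_digraph \<Rightarrow> ('a, 'b) pre_digraph \<Rightarrow> bool" where
  "weak_component G T \<longleftrightarrow> pre_digraph.max_subgraph G Digraph_Component.connected T"

(* G consists of H together with in-trees, each hanging on H by a single arc from its root.
   Two conventions are made explicit: H is contained in G as an induced subdigraph (no chords; this
   is automatic when H is bidirected complete), and the arc from the root of T is the only arc, in
   either direction, between T and H.  Without them the description would not determine the arcs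
   of G: for H a directed triangle, T = {x} and arcs (x,y), (y,x) with y in H, the root x is an
   inneighbor of exactly one vertex of H although G has an extra arc. *)
definition core_with_in_trees :: "('a, 'b) pre_digraph \<Rightarrow> ('a, 'b) pre_digraph \<Rightarrow> bool" where
  "core_with_in_trees G H \<longleftrightarrow> induced_subgraph H G \<and>
     (\<forall>T. weak_component (delete_verts G (verts H)) T \<longrightarrow>
        in_tree T \<and>
        (\<exists>x. in_tree_root T x \<and>
             (\<exists>!y. y \<in> verts H \<and> x \<rightarrow>\<^bsub>G\<^esub> y) \<and>
             (\<forall>u\<in>verts T. \<forall>y\<in>verts H. \<not> y \<rightarrow>\<^bsub>G\<^esub> u \<and> (u \<rightarrow>\<^bsub>G\<^esub> y \<longrightarrow> u = x))))"

end

theory Submission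
  imports Defs "Jordan_Normal_Form.Schur_Decomposition"
begin

text \<open>
  The sum of the squared eigenvalues is the trace of \<open>L\<^sup>2\<close>, i.e. the sum of the squared
  outdegrees plus the number of closed walks of length two; call this the energy.
  If \<open>H\<close> is a vertex set all of whose vertices have positive outdegree inside \<open>H\<close>, weak
  connectivity forces at least \<open>n - card H\<close> arcs outside \<open>H\<close>, so the energy of \<open>G\<close> is at least
  that of \<open>H\<close> plus \<open>n - card H\<close>.  Equality means that no arc leaves \<open>H\<close>, every vertex outside
  \<open>H\<close> has outdegree one and there are no further pairs of opposite arcs, i.e. that in-trees hang
  on \<open>H\<close>.  For \<open>r = 2\<close> take for \<open>H\<close> the vertices of any directed cycle.  For \<open>r \<ge> 3\<close> take a
  minimal set \<open>H\<close> without an acyclic \<open>(r - 1)\<close>-colouring; its vertices have outdegree at least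
  \<open>r - 1\<close> in \<open>H\<close>.  If \<open>card H = r + 1\<close>, each vertex misses at most one out-neighbour in \<open>H\<close>, which forces
  many pairs of opposite arcs, and if \<open>card H \<ge> r + 2\<close>, the degrees alone suffice, except for \<open>r = 3\<close>, \<open>card H = 5\<close>, where equality
  would make \<open>H\<close> a regular tournament, which is 2-colourable.
\<close>

section \<open>Eigenvalues and degrees\<close>

lemma sum_diag_mult_commute:
  fixes A B :: "'a::comm_semiring_0 mat"
  assumes "A \<in> carrier_mat n m" "B \<in> carrier_mat m n"
  shows "(\<Sum>i<n. (A * B) $$ (i, i)) = (\<Sum>i<m. (B * A) $$ (i, i))"
proof -
  have "(\<Sum>i<n. (A * B) $$ (i, i)) = (\<Sum>i<n. \<Sum>j<m. A $$ (i, j) * B $$ (j, i))"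
    using assms by (intro sum.cong refl) (auto simp: scalar_prod_def atLeast0LessThan)
  also have "\<dots> = (\<Sum>j<m. \<Sum>i<n. B $$ (j, i) * A $$ (i, j))"
    by (subst sum.swap) (simp add: mult.commute)
  also have "\<dots> = (\<Sum>i<m. (B * A) $$ (i, i))"
    using assms by (intro sum.cong refl) (auto simp: scalar_prod_def atLeast0LessThan)
  finally show ?thesis .
qed

lemma sum_diag_similar:
  fixes A B :: "'a::comm_ring_1 mat"
  assumes "similar_mat A B" "A \<in> carrier_mat n n"
  shows "(\<Sum>i<n. A $$ (i, i)) = (\<Sum>i<n. B $$ (i, i))"
proof -
  from assms(1) obtain P Q where "similar_mat_wit A B P Q" by (auto simp: similar_mat_def)
  note w = similar_mat_witD2[OF assms(2) this]
  have "(\<Sum>i<n. (P * B * Q) $$ (i, i)) = (\<Sum>i<n. (Q * (P * B)) $$ (i, i))"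
    using w by (intro sum_diag_mult_commute) auto
  also have "Q * (P * B) = B"
    using w(2) w(5) assoc_mult_mat[OF w(7) w(6) w(5)] by simp
  finally show ?thesis using w(3) by simp
qed

lemma order_prod_list_linear:
  "Polynomial.order (x::'a::field) (\<Prod>a\<leftarrow>es. [:- a, 1:]) = count_list es x"
proof (induction es)
  case (Cons a es)
  have "(\<Prod>b\<leftarrow>a # es. [:- b, 1:]) \<noteq> (0 :: 'a poly)"
    by (simp only: prod_list_zero_iff) auto
  then have "Polynomial.order x (\<Prod>b\<leftarrow>a # es. [:- b, 1:]) =
      Polynomial.order x [:- a, 1:] + Polynomial.order x (\<Prod>b\<leftarrow>es. [:- b, 1:])"
    by (simp add: order_mult del: mult_pCons_left)
  also have "Polynomial.order x [:- a, 1:] = (if a = x then 1 else 0)"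
    using order_power_n_n[of x 1] by (auto simp: order_0I)
  finally show ?case using Cons by simp
qed (simp add: order_0I)

lemma sum_list_eq_sum_count_list:
  fixes f :: "'a \<Rightarrow> 'b::comm_semiring_1"
  assumes "finite S" "set xs \<subseteq> S"
  shows "(\<Sum>x\<leftarrow>xs. f x) = (\<Sum>x\<in>S. of_nat (count_list xs x) * f x)"
  using assms(2)
proof (induction xs)
  case (Cons a xs)
  have "(\<Sum>x\<in>S. of_nat (count_list (a # xs) x) * f x) =
      (\<Sum>x\<in>S. (if a = x then f x else 0) + of_nat (count_list xs x) * f x)"
    by (intro sum.cong refl) (simp add: algebra_simps)
  also have "\<dots> = f a + (\<Sum>x\<leftarrow>xs. f x)"
    using Cons assms(1) by (simp add: sum.distrib)
  finally show ?case by simp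
qed simp

text \<open>Schur decomposition makes \<open>A\<close> similar to an upper triangular
  \<open>B\<close> carrying the eigenvalues on its diagonal, listed with multiplicity in
  \<open>es\<close>. Then \<open>A * A\<close> is similar to \<open>B * B\<close>, and similar
  matrices have equal trace.\<close>

lemma sum_eigenvalues_square:
  fixes A :: "complex mat"
  assumes A: "A \<in> carrier_mat n n"
  shows "(\<Sum>x | eigenvalue A x. of_nat (Polynomial.order x (char_poly A)) * x\<^sup>2) =
    (\<Sum>i<n. (A * A) $$ (i, i))"
proof -
  obtain es where es: "char_poly A = (\<Prod>a\<leftarrow>es. [:- a, 1:])"
    using char_poly_factorized[OF A] by blast
  obtain B P Q where "schur_decomposition A es = (B, P, Q)"
    by (cases "schur_decomposition A es") auto
  from schur_decomposition[OF A es this]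
  have w: "similar_mat_wit A B P Q" and ut: "upper_triangular B" and diag: "diag_mat B = es"
    by auto
  note B = similar_mat_witD2(5)[OF A w]
  have "similar_mat (A * A) (B * B)"
    using similar_mat_wit_pow[OF w, of 2] A B
    by (auto simp: similar_mat_def numeral_2_eq_2)
  then have "(\<Sum>i<n. (A * A) $$ (i, i)) = (\<Sum>i<n. (B * B) $$ (i, i))"
    using A by (intro sum_diag_similar) auto
  also have "\<dots> = (\<Sum>i<n. (B $$ (i, i))\<^sup>2)"
  proof (rule sum.cong[OF refl])
    fix i assume "i \<in> {..<n}"
    then have i: "i < n" by simp
    have "(B * B) $$ (i, i) = (\<Sum>j<n. B $$ (i, j) * B $$ (j, i))"
      using B i by (auto simp: scalar_prod_def atLeast0LessThan)
    \<comment> \<open>For \<open>j\<close> different from \<open>i\<close>, one of the entries at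
      \<open>(i, j)\<close> and \<open>(j, i)\<close> lies below the diagonal and vanishes.\<close>
    also have "\<dots> = (\<Sum>j<n. if j = i then (B $$ (i, i))\<^sup>2 else 0)"
    proof (rule sum.cong[OF refl])
      fix j assume "j \<in> {..<n}"
      then have "j < n" by simp
      then have "j < i \<Longrightarrow> B $$ (i, j) = 0" "i < j \<Longrightarrow> B $$ (j, i) = 0"
        using upper_triangularD[OF ut] B i by auto
      then show "B $$ (i, j) * B $$ (j, i) = (if j = i then (B $$ (i, i))\<^sup>2 else 0)"
        by (cases j i rule: linorder_cases) (auto simp: power2_eq_square)
    qed
    finally show "(B * B) $$ (i, i) = (B $$ (i, i))\<^sup>2" using i by simp
  qed
  also have "\<dots> = (\<Sum>a\<leftarrow>es. a\<^sup>2)"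
    unfolding diag[symmetric] using B
    by (simp add: diag_mat_def sum_list_sum_nth atLeast0LessThan)
  also have "\<dots> = (\<Sum>x\<in>set es. of_nat (count_list es x) * x\<^sup>2)"
    by (rule sum_list_eq_sum_count_list) auto
  also have "set es = {x. eigenvalue A x}"
    using eigenvalue_root_char_poly[OF A] unfolding es poly_prod_list
    by (auto simp: prod_list_zero_iff image_iff)
  finally show ?thesis unfolding es order_prod_list_linear by simp
qed

section \<open>Outdegrees, digons and the energy of a relation\<close>

definition outdeg_on :: "('a \<times> 'a) set \<Rightarrow> 'a set \<Rightarrow> 'a \<Rightarrow> nat" where
  "outdeg_on R S u = card {v \<in> S. (u, v) \<in> R}"

text \<open>The pairs are ordered, so two opposite arcs count twice; without loops the cardinality
  is the number of closed walks of length two, i.e. the trace of the squared adjacency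
  matrix.\<close>

definition digons :: "('a \<times> 'a) set \<Rightarrow> 'a set \<Rightarrow> ('a \<times> 'a) set" where
  "digons R S = {(u, v). u \<in> S \<and> v \<in> S \<and> (u, v) \<in> R \<and> (v, u) \<in> R}"

definition energy :: "('a \<times> 'a) set \<Rightarrow> 'a set \<Rightarrow> nat" where
  "energy R S = (\<Sum>u\<in>S. (outdeg_on R S u)\<^sup>2) + card (digons R S)"

text \<open>One side counts arcs, the other out-neighbours; in the absence of multiple arcs,
  \<open>head G\<close> is injective on the arcs leaving \<open>u\<close>.\<close>

lemma (in digraph) out_degree_eq_outdeg_on:
  "out_degree G u = outdeg_on (arcs_ends G) (verts G) u"
proof -
  have "bij_betw (head G) (out_arcs G u) {v \<in> verts G. (u, v) \<in> arcs_ends G}"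
    unfolding bij_betw_def
  proof
    show "inj_on (head G) (out_arcs G u)"
      by (auto simp: inj_on_def arc_to_ends_def intro: no_multi_arcs)
  qed (auto simp: arcs_ends_conv)
  then show ?thesis by (simp add: out_degree_def outdeg_on_def bij_betw_same_card)
qed

lemma sum_nth_distinct:
  assumes "distinct vs" "set vs = V"
  shows "(\<Sum>i<length vs. f (vs ! i)) = sum f V"
  using sum.reindex_bij_betw[OF bij_betw_nth[OF assms(1) refl refl]] assms(2) by simp

text \<open>The trace of the squared Laplacian is the sum of the products of its entries at
  \<open>(u, v)\<close> and \<open>(v, u)\<close>. The diagonal gives the squared outdegrees, as
  there are no loops; off the diagonal the signs cancel and exactly the digons contribute.\<close>

lemma (in digraph) LE_eq_energy:
  assumes "distinct vs" "set vs = verts G"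
  shows "LE G vs = of_nat (energy (arcs_ends G) (verts G))"
proof -
  let ?n = "length vs" and ?R = "arcs_ends G" and ?V = "verts G"
  let ?a = "\<lambda>u v. if (u, v) \<in> ?R then 1 else 0 :: complex"
  let ?d = "\<lambda>u v. if u = v then of_nat (outdeg_on ?R ?V u) else 0 :: complex"
  let ?L = "laplacian_mat G vs"
  have L: "?L \<in> carrier_mat ?n ?n"
    unfolding laplacian_mat_def adjacency_mat_def outdegree_mat_def by (intro minus_carrier_mat) auto
  have Lij: "?L $$ (i, j) = ?d (vs ! i) (vs ! j) - ?a (vs ! i) (vs ! j)" if "i < ?n" "j < ?n" for i j
    using that assms(1)
    by (simp add: laplacian_mat_def adjacency_mat_def outdegree_mat_def out_degree_eq_outdeg_on
        nth_eq_iff_index_eq)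
  define f where "f u v = (?d u v - ?a u v) * (?d v u - ?a v u)" for u v
  have f: "f u v = (if u = v then of_nat ((outdeg_on ?R ?V u)\<^sup>2) else 0) +
      (if (u, v) \<in> digons ?R ?V then 1 else 0)" if "u \<in> ?V" "v \<in> ?V" for u v
  proof (cases "u = v")
    case True
    then show ?thesis using adj_not_same[of v] by (auto simp: f_def digons_def power2_eq_square)
  next
    case False
    then show ?thesis using that by (simp add: f_def digons_def)
  qed
  have "LE G vs = (\<Sum>i<?n. (?L * ?L) $$ (i, i))"
    unfolding LE_def by (rule sum_eigenvalues_square[OF L])
  also have "\<dots> = (\<Sum>i<?n. \<Sum>j<?n. ?L $$ (i, j) * ?L $$ (j, i))"
    using L by (intro sum.cong refl) (auto simp: scalar_prod_def atLeast0LessThan)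
  also have "\<dots> = (\<Sum>i<?n. \<Sum>j<?n. f (vs ! i) (vs ! j))"
    by (intro sum.cong refl) (simp add: Lij f_def)
  also have "\<dots> = (\<Sum>i<?n. \<Sum>v\<in>?V. f (vs ! i) v)"
    by (intro sum.cong refl sum_nth_distinct[OF assms, of "f (vs ! _)"])
  also have "\<dots> = (\<Sum>u\<in>?V. \<Sum>v\<in>?V. f u v)"
    by (rule sum_nth_distinct[OF assms, of "\<lambda>u. \<Sum>v\<in>?V. f u v"])
  also have "\<dots> = (\<Sum>u\<in>?V. \<Sum>v\<in>?V. (if u = v then of_nat ((outdeg_on ?R ?V u)\<^sup>2) else 0) +
      (if (u, v) \<in> digons ?R ?V then 1 else 0))"
    by (intro sum.cong refl f)
  also have "\<dots> = (\<Sum>u\<in>?V. \<Sum>v\<in>?V. if u = v then of_nat ((outdeg_on ?R ?V u)\<^sup>2) else 0) +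
      (\<Sum>u\<in>?V. \<Sum>v\<in>?V. if (u, v) \<in> digons ?R ?V then 1 else 0)"
    by (simp only: sum.distrib)
  also have "(\<Sum>u\<in>?V. \<Sum>v\<in>?V. if (u, v) \<in> digons ?R ?V then 1 else 0 :: complex) =
      (\<Sum>p\<in>?V \<times> ?V. if p \<in> digons ?R ?V then 1 else 0)"
    unfolding sum.cartesian_product by (rule sum.cong) auto
  also have "\<dots> = (\<Sum>p\<in>digons ?R ?V. 1)"
    by (rule sum.mono_neutral_cong_right) (auto simp: digons_def)
  finally show ?thesis by (simp add: energy_def)
qed

section \<open>Weakly connected relations with a hanging part\<close>

text \<open>Weak connectivity in terms of cuts: every proper nonempty part is joined to the rest by
  an arc in some direction. This form delivers arcs one at a time while a vertex set grows;
  \<open>connected_iff_cut_connected\<close> links it to paths.\<close>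

definition cut_connected :: "('a \<times> 'a) set \<Rightarrow> 'a set \<Rightarrow> bool" where
  "cut_connected R V \<longleftrightarrow>
     (\<forall>S. S \<subseteq> V \<and> S \<noteq> {} \<and> S \<noteq> V \<longrightarrow> (\<exists>u\<in>S. \<exists>v\<in>V - S. (u, v) \<in> R \<or> (v, u) \<in> R))"

text \<open>The equality conditions of \<open>energy_ge_core\<close>, stated locally at vertices and
  arcs. In a weakly connected relation they describe in-trees hanging on \<open>H\<close>, see
  \<open>core_with_in_trees_iff_hanging\<close>.\<close>

definition hanging :: "('a \<times> 'a) set \<Rightarrow> 'a set \<Rightarrow> 'a set \<Rightarrow> bool" where
  "hanging R V H \<longleftrightarrow> (\<forall>u\<in>H. \<forall>v\<in>V - H. (u, v) \<notin> R) \<and> (\<forall>u\<in>V - H. outdeg_on R V u = 1) \<and>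
     digons R V \<subseteq> H \<times> H"

section \<open>Counting arcs outside a core\<close>

lemma cut_connectedE:
  assumes "cut_connected R V" "S \<subseteq> V" "S \<noteq> {}" "S \<noteq> V"
  obtains u v where "u \<in> S" "v \<in> V - S" "(u, v) \<in> R \<or> (v, u) \<in> R"
  using assms unfolding cut_connected_def by blast

text \<open>Let \<open>S\<close> grow to \<open>V\<close> by one vertex at a time. Each new vertex
  is joined to the current set by an arc that was outside \<open>S \<times> S\<close> and falls
  inside the enlarged square, so every vertex costs a fresh arc.\<close>

lemma card_arcs_outside_ge:
  assumes "finite V" "cut_connected R V" "S \<subseteq> V" "S \<noteq> {}"
  shows "card (V - S) \<le> card (R \<inter> V \<times> V - S \<times> S)"
  using assms(3,4)
proof (induction "card (V - S)" arbitrary: S)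
  case (Suc k)
  have fin: "finite (R \<inter> V \<times> V - S \<times> S)" using assms(1) by auto
  from Suc.hyps(2) have "S \<noteq> V" by auto
  then obtain u v where uv: "u \<in> S" "v \<in> V - S" "(u, v) \<in> R \<or> (v, u) \<in> R"
    using cut_connectedE[OF assms(2)] Suc.prems by metis
  have card: "card (V - S) = Suc (card (V - insert v S))"
    using card_Suc_Diff1[OF finite_Diff[OF assms(1)] uv(2)] unfolding Diff_insert[of V v S] by (rule sym)
  have "card (V - insert v S) \<le> card (R \<inter> V \<times> V - insert v S \<times> insert v S)"
  proof (rule Suc.hyps(1))
    show "k = card (V - insert v S)" using Suc.hyps(2) card by linarith
  qed (use Suc.prems uv in auto)
  also have "\<dots> < card (R \<inter> V \<times> V - S \<times> S)"
    using uv Suc.prems by (intro psubset_card_mono[OF fin]) auto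
  finally show ?case using card by simp
qed simp

lemma sum_outdeg_on:
  assumes "finite S"
  shows "(\<Sum>u\<in>S. outdeg_on R S u) = card (R \<inter> S \<times> S)"
proof -
  have "R \<inter> S \<times> S = (SIGMA u:S. {v \<in> S. (u, v) \<in> R})" by auto
  then show ?thesis using assms by (simp add: outdeg_on_def)
qed

lemma outdeg_on_mono:
  "finite T \<Longrightarrow> S \<subseteq> T \<Longrightarrow> outdeg_on R S u \<le> outdeg_on R T u"
  unfolding outdeg_on_def by (rule card_mono) auto

lemma outdeg_on_eq_imp:
  assumes "finite T" "S \<subseteq> T" "outdeg_on R S u = outdeg_on R T u" "v \<in> T" "(u, v) \<in> R"
  shows "v \<in> S"
proof -
  have "{v \<in> S. (u, v) \<in> R} = {v \<in> T. (u, v) \<in> R}"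
    using assms(1-3) unfolding outdeg_on_def by (intro card_subset_eq) auto
  then show ?thesis using assms(4,5) by auto
qed

lemma outdeg_on_eq_0_iff:
  "finite S \<Longrightarrow> outdeg_on R S u = 0 \<longleftrightarrow> (\<forall>v\<in>S. (u, v) \<notin> R)"
  by (auto simp: outdeg_on_def)

lemma outdeg_on_eq_1E:
  assumes "outdeg_on R V u = 1"
  obtains v where "v \<in> V" "(u, v) \<in> R" "\<And>w. w \<in> V \<Longrightarrow> (u, w) \<in> R \<Longrightarrow> w = v"
  using assms unfolding outdeg_on_def One_nat_def card_1_singleton_iff by blast

lemma outdeg_on_eq_1_unique:
  assumes "outdeg_on R V u = 1" "v \<in> V" "(u, v) \<in> R" "w \<in> V" "(u, w) \<in> R"
  shows "v = w"
  using outdeg_on_eq_1E[OF assms(1)] assms(2-) by metis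

lemma finite_digons: "finite S \<Longrightarrow> finite (digons R S)"
  by (rule finite_subset[of _ "S \<times> S"]) (auto simp: digons_def)

text \<open>This is strict monotonicity of \<open>x^2 - x\<close> on the positive integers, arranged
  so that no subtraction occurs.\<close>

lemma square_plus_le:
  fixes a b :: nat
  assumes "1 \<le> a" "a \<le> b"
  shows "a\<^sup>2 + b \<le> b\<^sup>2 + a" and "a\<^sup>2 + b = b\<^sup>2 + a \<Longrightarrow> a = b"
proof -
  obtain c where c: "a = Suc c" using assms(1) by (cases a) auto
  obtain k where k: "b = Suc c + k" using assms(2) c le_Suc_ex by blast
  have "b\<^sup>2 + a = a\<^sup>2 + b + (2 * c * k + k * k + k)"
    by (simp add: c k power2_eq_square algebra_simps)
  then show "a\<^sup>2 + b \<le> b\<^sup>2 + a" "a\<^sup>2 + b = b\<^sup>2 + a \<Longrightarrow> a = b"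
    using c k by auto
qed

lemma energy_hanging:
  assumes "finite V" "H \<subseteq> V" "hanging R V H"
  shows "energy R V = energy R H + card (V - H)"
proof -
  have "digons R V = digons R H"
    using assms(2,3) by (auto simp: hanging_def digons_def)
  moreover have "(\<Sum>u\<in>V. (outdeg_on R V u)\<^sup>2) = (\<Sum>u\<in>V - H. (outdeg_on R V u)\<^sup>2) + (\<Sum>u\<in>H. (outdeg_on R V u)\<^sup>2)"
    using assms by (intro sum.subset_diff) auto
  moreover have "(\<Sum>u\<in>V - H. (outdeg_on R V u)\<^sup>2) = card (V - H)"
    using assms(3) by (simp add: hanging_def)
  moreover have "(\<Sum>u\<in>H. (outdeg_on R V u)\<^sup>2) = (\<Sum>u\<in>H. (outdeg_on R H u)\<^sup>2)"
    using assms(2,3) unfolding hanging_def outdeg_on_def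
    by (intro sum.cong refl arg_cong[where f = "\<lambda>A. (card A)\<^sup>2"]) auto
  ultimately show ?thesis by (simp add: energy_def)
qed

text \<open>At a vertex of \<open>H\<close>, passing from \<open>H\<close> to \<open>V\<close>
  raises the squared outdegree by at least as much as the outdegree; outside \<open>H\<close> the
  square dominates the outdegree itself. Summed up, the energy grows by at least the number of arcs
  not inside \<open>H\<close>, which is at least \<open>card (V - H)\<close>. In the equality case
  each of these estimates is tight.\<close>

lemma energy_ge_core:
  assumes V: "finite V" "cut_connected R V" and H: "H \<subseteq> V" "H \<noteq> {}"
    and deg: "\<And>u. u \<in> H \<Longrightarrow> 1 \<le> outdeg_on R H u"
  shows "energy R H + card (V - H) \<le> energy R V"
    and "energy R V = energy R H + card (V - H) \<Longrightarrow> hanging R V H"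
proof -
  let ?dV = "outdeg_on R V" and ?dH = "outdeg_on R H"
  have finH: "finite H" and finD: "finite (V - H)" using V(1) H(1) finite_subset by auto
  \<comment> \<open>\<open>f\<close> and \<open>g\<close> are the two sides of the vertexwise
    comparison, with the negative terms moved across.\<close>
  define f where "f u = (if u \<in> H then (?dH u)\<^sup>2 + ?dV u else ?dV u)" for u
  define g where "g u = (if u \<in> H then (?dV u)\<^sup>2 + ?dH u else (?dV u)\<^sup>2)" for u
  have fg: "f u \<le> g u" for u
    using square_plus_le(1)[OF deg outdeg_on_mono[OF V(1) H(1)]]
    by (auto simp: f_def g_def power2_eq_square)
  have split: "(\<Sum>u\<in>V. h u) = (\<Sum>u\<in>V - H. h u) + (\<Sum>u\<in>H. h u)" for h :: "_ \<Rightarrow> nat"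
    using V H by (intro sum.subset_diff) auto
  have sum_f: "sum f V = (\<Sum>u\<in>V. ?dV u) + (\<Sum>u\<in>H. (?dH u)\<^sup>2)"
    unfolding split[of f] split[of ?dV] by (simp add: f_def sum.distrib)
  have sum_g: "sum g V = (\<Sum>u\<in>V. (?dV u)\<^sup>2) + (\<Sum>u\<in>H. ?dH u)"
    unfolding split[of g] split[of "\<lambda>u. (?dV u)\<^sup>2"] by (simp add: g_def sum.distrib)
  have "card (R \<inter> V \<times> V) = card ((R \<inter> V \<times> V - H \<times> H) \<union> (R \<inter> H \<times> H))"
    using H(1) by (intro arg_cong[where f = card]) auto
  also have "\<dots> = card (R \<inter> V \<times> V - H \<times> H) + card (R \<inter> H \<times> H)"
    using V(1) finH by (intro card_Un_disjoint) auto
  finally have arcs: "(\<Sum>u\<in>V. ?dV u) = card (R \<inter> V \<times> V - H \<times> H) + (\<Sum>u\<in>H. ?dH u)"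
    using V(1) finH by (simp add: sum_outdeg_on)
  have dig: "digons R H \<subseteq> digons R V" using H(1) by (auto simp: digons_def)
  then have card_dig: "card (digons R H) \<le> card (digons R V)"
    using V(1) by (intro card_mono finite_digons)
  have outside: "card (V - H) \<le> card (R \<inter> V \<times> V - H \<times> H)"
    using V H by (rule card_arcs_outside_ge)
  have le: "sum f V \<le> sum g V" by (intro sum_mono fg)
  show "energy R H + card (V - H) \<le> energy R V"
    using le outside card_dig unfolding sum_f sum_g arcs energy_def by linarith
  assume eq: "energy R V = energy R H + card (V - H)"
  have fg_eq: "sum f V = sum g V" and out_eq: "card (R \<inter> V \<times> V - H \<times> H) = card (V - H)"
    and dig_eq: "card (digons R H) = card (digons R V)"
    using eq le outside card_dig unfolding sum_f sum_g arcs energy_def by linarith+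
  have fg': "f u = g u" if "u \<in> V" for u
    using sum_mono_inv[OF fg_eq] fg that V(1) by blast
  have inner: "?dH u = ?dV u" if "u \<in> H" for u
    using square_plus_le(2)[OF deg outdeg_on_mono[OF V(1) H(1)]] fg'[of u] that H(1)
    by (auto simp: f_def g_def)
  have outer: "?dV u \<le> 1" if "u \<in> V - H" for u
  proof -
    from fg'[of u] that have "?dV u = ?dV u * ?dV u" by (auto simp: f_def g_def power2_eq_square)
    then show ?thesis by (cases "?dV u = 0") auto
  qed
  \<comment> \<open>The vertices outside \<open>H\<close> have outdegree at most one, and tightness
    of the arc count makes these outdegrees sum to \<open>card (V - H)\<close>; hence all of them
    are one.\<close>
  have "(\<Sum>u\<in>H. ?dV u) = (\<Sum>u\<in>H. ?dH u)" using inner by (intro sum.cong) auto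
  then have "(\<Sum>u\<in>V - H. ?dV u) = (\<Sum>u\<in>V - H. 1)"
    using arcs out_eq unfolding split[of ?dV] by simp
  then have "?dV u = 1" if "u \<in> V - H" for u
    using sum_mono_inv[of ?dV "V - H" "\<lambda>_. 1"] outer that finD by blast
  moreover have "(u, v) \<notin> R" if "u \<in> H" "v \<in> V - H" for u v
    using outdeg_on_eq_imp[OF V(1) H(1) inner] that by blast
  moreover have "digons R V = digons R H"
    using card_subset_eq[OF finite_digons[OF V(1)] dig dig_eq] by simp
  then have "digons R V \<subseteq> H \<times> H" by (auto simp: digons_def)
  ultimately show "hanging R V H" unfolding hanging_def by blast
qed

text \<open>Let \<open>A\<close> be the set of vertices from which \<open>H\<close> can be reached.
  No arc enters \<open>A\<close> from outside, so a crossing arc leaves \<open>A\<close> at some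
  \<open>u\<close>, which is not in \<open>H\<close>. The only arc out of \<open>u\<close> starts
  its path to \<open>H\<close>, so it ends in \<open>A\<close> after all.\<close>

lemma hanging_reaches_core:
  assumes "cut_connected R V" "hanging R V H" "H \<subseteq> V" "H \<noteq> {}" "v \<in> V"
  shows "\<exists>h\<in>H. (v, h) \<in> (R \<inter> V \<times> V)\<^sup>*"
proof (rule ccontr)
  let ?R = "R \<inter> V \<times> V"
  define A where "A = {u \<in> V. \<exists>h\<in>H. (u, h) \<in> ?R\<^sup>*}"
  assume "\<not> ?thesis"
  then have "A \<noteq> V" using assms(5) by (auto simp: A_def)
  moreover have "H \<subseteq> A" "A \<subseteq> V" using assms(3) by (auto simp: A_def)
  ultimately obtain u w where uw: "u \<in> A" "w \<in> V - A" "(u, w) \<in> R \<or> (w, u) \<in> R"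
    using cut_connectedE[OF assms(1), of A] assms(4) by blast
  from uw(1) obtain h where h: "h \<in> H" "(u, h) \<in> ?R\<^sup>*" "u \<in> V" by (auto simp: A_def)
  have "(w, u) \<notin> R"
    using uw h by (auto simp: A_def intro: converse_rtrancl_into_rtrancl)
  then have "(u, w) \<in> R" using uw by blast
  then have "u \<notin> H" using assms(2) uw \<open>H \<subseteq> A\<close> by (auto simp: hanging_def)
  then obtain w' where w': "(u, w') \<in> ?R" "(w', h) \<in> ?R\<^sup>*"
    using h by (metis converse_rtranclE)
  have "outdeg_on R V u = 1" using assms(2) h \<open>u \<notin> H\<close> by (auto simp: hanging_def)
  then have "w' = w" using outdeg_on_eq_1_unique[of R V u w' w] w' \<open>(u, w) \<in> R\<close> uw by blast
  then show False using w' h uw by (auto simp: A_def)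
qed

text \<open>The rank is the distance to \<open>H\<close>. A vertex outside \<open>H\<close> has a
  single out-neighbour, so its walks to \<open>H\<close> are those of that neighbour prolonged by
  one arc.\<close>

lemma hanging_rank:
  assumes "cut_connected R V" "hanging R V H" "H \<subseteq> V" "H \<noteq> {}"
  obtains \<rho> :: "'a \<Rightarrow> nat" where
    "\<And>u v. u \<in> V - H \<Longrightarrow> v \<in> V \<Longrightarrow> (u, v) \<in> R \<Longrightarrow> \<rho> u = Suc (\<rho> v)"
proof
  let ?R = "R \<inter> V \<times> V"
  define \<rho> where "\<rho> u = (LEAST k. \<exists>h\<in>H. (u, h) \<in> ?R ^^ k)" for u
  fix u v assume uv: "u \<in> V - H" "v \<in> V" "(u, v) \<in> R"
  obtain h k where hk: "h \<in> H" "(u, h) \<in> ?R ^^ k"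
    using hanging_reaches_core[OF assms, of u] uv rtrancl_imp_relpow by blast
  have "outdeg_on R V u = 1" using assms(2) uv by (auto simp: hanging_def)
  then have unique: "w = v" if "(u, w) \<in> ?R" for w
    using outdeg_on_eq_1_unique[of R V u w v] uv that by blast
  have "(u, h) \<in> ?R ^^ Suc k \<longleftrightarrow> (v, h) \<in> ?R ^^ k" for h k
  proof
    assume "(u, h) \<in> ?R ^^ Suc k"
    then obtain w where "(u, w) \<in> ?R" "(w, h) \<in> ?R ^^ k" by (rule relpow_Suc_E2)
    then show "(v, h) \<in> ?R ^^ k" using unique by blast
  next
    assume "(v, h) \<in> ?R ^^ k"
    moreover have "(u, v) \<in> ?R" using uv by blast
    ultimately show "(u, h) \<in> ?R ^^ Suc k" by (rule relpow_Suc_I2[rotated])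
  qed
  then have step: "(\<exists>h\<in>H. (u, h) \<in> ?R ^^ Suc k) \<longleftrightarrow> (\<exists>h\<in>H. (v, h) \<in> ?R ^^ k)" for k
    by blast
  \<comment> \<open>Length 0 is impossible because \<open>u\<close> is not in \<open>H\<close>; this
    allows the least length to be shifted by one.\<close>
  have "\<not> (\<exists>h\<in>H. (u, h) \<in> ?R ^^ 0)" using uv by auto
  then have "\<rho> u = Suc (LEAST k. \<exists>h\<in>H. (u, h) \<in> ?R ^^ Suc k)"
    unfolding \<rho>_def using hk by (intro Least_Suc[where n = k]) auto
  then show "\<rho> u = Suc (\<rho> v)" unfolding step by (simp add: \<rho>_def)
qed

text \<open>The arcs of \<open>U\<close> number at least \<open>card U - 1\<close>, so at most one vertex of \<open>U\<close> can lack an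
  out-neighbour.\<close>

lemma outdeg_on_eq_1_of_root:
  assumes "finite U" "cut_connected R U" "x \<in> U" "outdeg_on R U x = 0"
    and "\<And>u. u \<in> U \<Longrightarrow> outdeg_on R U u \<le> 1"
  shows "\<And>u. u \<in> U - {x} \<Longrightarrow> outdeg_on R U u = 1"
    and "card (R \<inter> U \<times> U) = card (U - {x})"
proof -
  have "card (U - {x}) \<le> card (R \<inter> U \<times> U - {x} \<times> {x})"
    using assms by (intro card_arcs_outside_ge) auto
  also have "\<dots> \<le> card (R \<inter> U \<times> U)"
    using assms(1) by (intro card_mono) auto
  finally have 1: "card (U - {x}) \<le> card (R \<inter> U \<times> U)" .
  have 2: "card (R \<inter> U \<times> U) = (\<Sum>u\<in>U - {x}. outdeg_on R U u)"
    using sum_outdeg_on[OF assms(1), of R] sum.remove[OF assms(1,3), of "outdeg_on R U"] assms(4) by simp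
  have 3: "(\<Sum>u\<in>U - {x}. outdeg_on R U u) \<le> (\<Sum>u\<in>U - {x}. 1)"
    using assms(5) by (intro sum_mono) auto
  show eq: "card (R \<inter> U \<times> U) = card (U - {x})" using 1 2 3 by simp
  have "(\<Sum>u\<in>U - {x}. outdeg_on R U u) = (\<Sum>u\<in>U - {x}. 1)" using eq 2 by simp
  then show "outdeg_on R U u = 1" if "u \<in> U - {x}" for u
    using sum_mono_inv[of "outdeg_on R U" "U - {x}" "\<lambda>_. 1"] assms(1,5) that by blast
qed

text \<open>The root is a vertex of \<open>U\<close> closest to \<open>H\<close>: its out-neighbour
  is closer still, so it is not in \<open>U\<close> and, by closedness, lies in \<open>H\<close>.
  Every other vertex already spends its only arc inside \<open>U\<close>.\<close>

lemma hanging_component_root: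
  assumes V: "finite V" "cut_connected R V" and H: "hanging R V H" "H \<subseteq> V" "H \<noteq> {}"
    and U: "U \<subseteq> V - H" "U \<noteq> {}" "cut_connected R U"
    and closed: "\<And>u v. u \<in> U \<Longrightarrow> v \<in> V - H \<Longrightarrow> (u, v) \<in> R \<Longrightarrow> v \<in> U"
  obtains x where "{u \<in> U. outdeg_on R U u = 0} = {x}" "\<exists>!y. y \<in> H \<and> (x, y) \<in> R"
    "\<forall>u\<in>U. \<forall>y\<in>H. (u, y) \<in> R \<longrightarrow> u = x"
proof -
  obtain \<rho> :: "'a \<Rightarrow> nat" where
    \<rho>: "\<And>u v. u \<in> V - H \<Longrightarrow> v \<in> V \<Longrightarrow> (u, v) \<in> R \<Longrightarrow> \<rho> u = Suc (\<rho> v)"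
    using hanging_rank[OF V(2) H] by blast
  have finU: "finite U" using U(1) V(1) finite_subset by blast
  obtain x where x: "x \<in> U" "\<And>u. u \<in> U \<Longrightarrow> \<rho> x \<le> \<rho> u"
    using finU U(2) by (metis arg_min_if_finite(1) arg_min_least)
  have deg1: "outdeg_on R V u = 1" if "u \<in> U" for u using H(1) U(1) that by (auto simp: hanging_def)
  have le1: "outdeg_on R U u \<le> 1" if "u \<in> U" for u
    using outdeg_on_mono[OF V(1), of U R u] deg1[OF that] U(1) by auto
  obtain y where y: "y \<in> V" "(x, y) \<in> R" "\<And>w. w \<in> V \<Longrightarrow> (x, w) \<in> R \<Longrightarrow> w = y"
    using outdeg_on_eq_1E[OF deg1[OF x(1)]] by blast
  have "\<rho> x = Suc (\<rho> y)" using \<rho> x(1) y(1,2) U(1) by blast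
  then have "y \<notin> U" using x(2)[of y] by auto
  then have "\<forall>v\<in>U. (x, v) \<notin> R" using y(3) U(1) by blast
  then have x0: "outdeg_on R U x = 0" unfolding outdeg_on_eq_0_iff[OF finU] .
  have others: "outdeg_on R U u = 1" if "u \<in> U - {x}" for u
    using outdeg_on_eq_1_of_root(1)[OF finU U(3) x(1) x0 le1 that] .
  then have root_unique: "u = x" if "u \<in> U" "outdeg_on R U u = 0" for u
    using that by force
  show thesis
  proof
    show "{u \<in> U. outdeg_on R U u = 0} = {x}" using x(1) x0 root_unique by blast
    show "\<exists>!y. y \<in> H \<and> (x, y) \<in> R"
      using y \<open>y \<notin> U\<close> closed[OF x(1), of y] H(2) by blast
    show "\<forall>u\<in>U. \<forall>y\<in>H. (u, y) \<in> R \<longrightarrow> u = x"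
    proof (intro ballI impI)
      fix u z assume uz: "u \<in> U" "z \<in> H" "(u, z) \<in> R"
      show "u = x"
      proof (rule ccontr)
        assume "u \<noteq> x"
        then have "outdeg_on R U u = 1" using others uz by blast
        then obtain v where "v \<in> U" "(u, v) \<in> R" by (rule outdeg_on_eq_1E)
        then have "v = z"
          using outdeg_on_eq_1_unique[OF deg1[OF uz(1)], of v z] uz U(1) H(2) by blast
        then show False using \<open>v \<in> U\<close> uz U(1) by blast
      qed
    qed
  qed
qed

text \<open>At a vertex of maximal rank both edges of the cycle must be directed outwards, since an
  arc into it would start at a larger rank. As \<open>n\<close> is at least 3, they lead to
  different vertices, against outdegree one.\<close>

lemma hanging_no_undirected_cycle:
  assumes V: "finite V" "cut_connected R V" and H: "hanging R V H" "H \<subseteq> V" "H \<noteq> {}"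
    and n: "3 \<le> n" and inj: "inj_on c {..<n}" and c: "\<And>i. i < n \<Longrightarrow> c i \<in> V - H"
    and adj: "\<And>i. i < n \<Longrightarrow> (c i, c (Suc i mod n)) \<in> R \<or> (c (Suc i mod n), c i) \<in> R"
  shows False
proof -
  obtain \<rho> :: "'a \<Rightarrow> nat" where
    \<rho>: "\<And>u v. u \<in> V - H \<Longrightarrow> v \<in> V \<Longrightarrow> (u, v) \<in> R \<Longrightarrow> \<rho> u = Suc (\<rho> v)"
    using hanging_rank[OF V(2) H] by blast
  let ?M = "(\<lambda>i. \<rho> (c i)) ` {..<n}"
  have "0 \<in> {..<n}" using n by simp
  then have "Max ?M \<in> ?M" by (intro Max_in) blast+
  then obtain i where "i < n" "\<rho> (c i) = Max ?M" by auto
  then have i: "i < n" "\<And>j. j < n \<Longrightarrow> \<rho> (c j) \<le> \<rho> (c i)" by auto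
  \<comment> \<open>\<open>a\<close> and \<open>b\<close> are the cyclic successor and predecessor
    of the position \<open>i\<close>.\<close>
  define a where "a = Suc i mod n"
  define b where "b = (if i = 0 then n - 1 else i - 1)"
  have ab: "a < n" "b < n" "a \<noteq> b" "Suc b mod n = i"
    using n i(1) by (auto simp: a_def b_def mod_Suc)
  have up: "(c i, c j) \<in> R" if "j < n" "(c i, c j) \<in> R \<or> (c j, c i) \<in> R" for j
    using that \<rho>[of "c j" "c i"] i c[of j] c[of i] by fastforce
  have "(c i, c a) \<in> R" "(c i, c b) \<in> R"
    using up[OF ab(1)] up[OF ab(2)] adj[OF i(1)] adj[OF ab(2)] ab(4) by (auto simp: a_def)
  moreover have "outdeg_on R V (c i) = 1" using H(1) c[OF i(1)] by (simp add: hanging_def)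
  ultimately have "c a = c b"
    using outdeg_on_eq_1_unique[of R V "c i" "c a" "c b"] c[OF ab(1)] c[OF ab(2)] by blast
  then show False using inj ab by (auto dest: inj_onD)
qed

text \<open>The demands of \<open>core_with_in_trees\<close> on a component, expressed by arcs
  alone: \<open>U\<close> stands for its vertex set, \<open>x\<close> for its root.\<close>

definition attached_component ::
    "('a \<times> 'a) set \<Rightarrow> 'a set \<Rightarrow> 'a set \<Rightarrow> 'a set \<Rightarrow> 'a \<Rightarrow> bool" where
  "attached_component R V H U x \<longleftrightarrow> U \<subseteq> V - H \<and> cut_connected R U \<and>
     (\<forall>u\<in>U. \<forall>v\<in>V - H. (u, v) \<in> R \<longrightarrow> v \<in> U) \<and> (\<forall>u\<in>U. outdeg_on R U u \<le> 1) \<and>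
     {u \<in> U. outdeg_on R U u = 0} = {x} \<and> (\<exists>!y. y \<in> H \<and> (x, y) \<in> R) \<and>
     (\<forall>u\<in>U. \<forall>y\<in>H. (y, u) \<notin> R \<and> ((u, y) \<in> R \<longrightarrow> u = x))"

lemma attached_componentD:
  assumes "attached_component R V H U x"
  shows "U \<subseteq> V - H" "cut_connected R U"
    and "\<And>u v. u \<in> U \<Longrightarrow> v \<in> V - H \<Longrightarrow> (u, v) \<in> R \<Longrightarrow> v \<in> U"
    and "\<And>u. u \<in> U \<Longrightarrow> outdeg_on R U u \<le> 1"
    and "x \<in> U" "outdeg_on R U x = 0" "\<And>u. u \<in> U \<Longrightarrow> outdeg_on R U u = 0 \<Longrightarrow> u = x"
    and "\<exists>!y. y \<in> H \<and> (x, y) \<in> R"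
    and "\<And>u y. u \<in> U \<Longrightarrow> y \<in> H \<Longrightarrow> (y, u) \<notin> R"
    and "\<And>u y. u \<in> U \<Longrightarrow> y \<in> H \<Longrightarrow> (u, y) \<in> R \<Longrightarrow> u = x"
proof -
  note assms[unfolded attached_component_def]
  then have *: "U \<subseteq> V - H" "cut_connected R U"
     "\<forall>u\<in>U. \<forall>v\<in>V - H. (u, v) \<in> R \<longrightarrow> v \<in> U" "\<forall>u\<in>U. outdeg_on R U u \<le> 1"
     "{u \<in> U. outdeg_on R U u = 0} = {x}" "\<exists>!y. y \<in> H \<and> (x, y) \<in> R"
     "\<forall>u\<in>U. \<forall>y\<in>H. (y, u) \<notin> R \<and> ((u, y) \<in> R \<longrightarrow> u = x)"
    by - (elim conjE, assumption)+
  show "U \<subseteq> V - H" "cut_connected R U" "\<exists>!y. y \<in> H \<and> (x, y) \<in> R"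
    by (fact *)+
  show "\<And>u v. u \<in> U \<Longrightarrow> v \<in> V - H \<Longrightarrow> (u, v) \<in> R \<Longrightarrow> v \<in> U"
    using *(3) by blast
  show "\<And>u. u \<in> U \<Longrightarrow> outdeg_on R U u \<le> 1" using *(4) by blast
  show "x \<in> U" "outdeg_on R U x = 0" "\<And>u. u \<in> U \<Longrightarrow> outdeg_on R U u = 0 \<Longrightarrow> u = x"
    using *(5) by blast+
  show "\<And>u y. u \<in> U \<Longrightarrow> y \<in> H \<Longrightarrow> (y, u) \<notin> R"
    "\<And>u y. u \<in> U \<Longrightarrow> y \<in> H \<Longrightarrow> (u, y) \<in> R \<Longrightarrow> u = x"
    using *(7) by blast+
qed

text \<open>The root has its only arc into \<open>H\<close>, every other vertex of a component its
  only arc inside the component. Digons are excluded by counting: a component has one arc fewer than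
  vertices, and connectivity tolerates no smaller number.\<close>

lemma hangingI_components:
  assumes V: "finite V" "H \<subseteq> V"
    and comp: "\<And>u. u \<in> V - H \<Longrightarrow> \<exists>U x. u \<in> U \<and> attached_component R V H U x"
  shows "hanging R V H"
  unfolding hanging_def
proof (intro conjI ballI)
  fix u v assume uv: "u \<in> H" "v \<in> V - H"
  from comp[OF uv(2)] obtain U x where "v \<in> U" "attached_component R V H U x" by blast
  then show "(u, v) \<notin> R" using uv(1) by (intro attached_componentD(9))
next
  fix u assume "u \<in> V - H"
  then obtain U x where u: "u \<in> U" and att: "attached_component R V H U x" using comp by blast
  note att = attached_componentD[OF att]
  have finU: "finite U" using att(1) V(1) by (meson finite_Diff rev_finite_subset)
  have closed: "v \<in> U" if "v \<in> V - H" "(u, v) \<in> R" for v using att(3) u that by blast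
  show "outdeg_on R V u = 1"
  proof (cases "u = x")
    case True
    have "outdeg_on R U u = 0" using att(6) True by simp
    then have "\<forall>v\<in>U. (u, v) \<notin> R" unfolding outdeg_on_eq_0_iff[OF finU] .
    then have "{v \<in> V. (u, v) \<in> R} = {v. v \<in> H \<and> (u, v) \<in> R}" using closed V(2) by blast
    moreover obtain y where "{v. v \<in> H \<and> (u, v) \<in> R} = {y}" using att(8) True by blast
    ultimately show ?thesis by (simp add: outdeg_on_def)
  next
    case False
    have "outdeg_on R U u \<noteq> 0" "outdeg_on R U u \<le> 1" using att(4,7) u False by blast+
    then have "outdeg_on R U u = 1" by simp
    moreover have "{v \<in> V. (u, v) \<in> R} = {v \<in> U. (u, v) \<in> R}"
      using att(1,10) u False closed by blast
    ultimately show ?thesis by (simp add: outdeg_on_def)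
  qed
next
  have outside: False if uv: "u \<in> V - H" "v \<in> V" "(u, v) \<in> R" "(v, u) \<in> R" for u v
  proof -
    obtain U x where u: "u \<in> U" and att: "attached_component R V H U x" using comp[OF uv(1)] by blast
    note att = attached_componentD[OF att]
    have finU: "finite U" using att(1) V(1) by (meson finite_Diff rev_finite_subset)
    \<comment> \<open>\<open>v\<close> is not in \<open>H\<close>, because no arc from
      \<open>H\<close> enters \<open>U\<close>; closedness then puts it into
      \<open>U\<close>.\<close>
    have v: "v \<in> U" using att(3,9) u uv by blast
    let ?R = "R - {(u, v)}"
    \<comment> \<open>Dropping one arc of a digon keeps \<open>U\<close> connected, but leaves too few arcs.\<close>
    have "cut_connected ?R U"
      unfolding cut_connected_def
    proof (intro allI impI)
      fix S assume "S \<subseteq> U \<and> S \<noteq> {} \<and> S \<noteq> U"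
      then obtain a b where "a \<in> S" "b \<in> U - S" "(a, b) \<in> R \<or> (b, a) \<in> R"
        using cut_connectedE[OF att(2)] by metis
      moreover from this have "(a, b) \<in> ?R \<or> (b, a) \<in> ?R" using uv(4) by blast
      ultimately show "\<exists>a\<in>S. \<exists>b\<in>U - S. (a, b) \<in> ?R \<or> (b, a) \<in> ?R" by blast
    qed
    then have "card (U - {x}) \<le> card (?R \<inter> U \<times> U - {x} \<times> {x})"
      using finU att(5) by (intro card_arcs_outside_ge) auto
    also have "\<dots> \<le> card (?R \<inter> U \<times> U)"
      using finU by (intro card_mono) auto
    also have "\<dots> < card (R \<inter> U \<times> U)"
      using finU uv u v by (intro psubset_card_mono) auto
    finally show False
      using outdeg_on_eq_1_of_root(2)[OF finU att(2,5,6,4)] by simp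
  qed
  show "digons R V \<subseteq> H \<times> H"
  proof (rule subrelI)
    fix u v assume "(u, v) \<in> digons R V"
    then have "u \<in> V" "v \<in> V" "(u, v) \<in> R" "(v, u) \<in> R" by (auto simp: digons_def)
    then show "(u, v) \<in> H \<times> H" using outside[of u v] outside[of v u] by blast
  qed
qed

section \<open>Weak components and in-trees\<close>

lemma arcs_ends_induce_subgraph: "arcs_ends (G \<restriction> S) = arcs_ends G \<inter> S \<times> S"
  by (auto simp: arcs_ends_conv)

lemma cut_connected_mono: "cut_connected R U \<Longrightarrow> R \<subseteq> R' \<Longrightarrow> cut_connected R' U"
  unfolding cut_connected_def by (meson subsetD)

lemma cut_connected_Restr:
  assumes "U \<subseteq> W"
  shows "cut_connected (R \<inter> W \<times> W) U \<longleftrightarrow> cut_connected R U"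
proof
  assume R: "cut_connected R U"
  show "cut_connected (R \<inter> W \<times> W) U"
    unfolding cut_connected_def
  proof (intro allI impI)
    fix S assume S: "S \<subseteq> U \<and> S \<noteq> {} \<and> S \<noteq> U"
    then obtain a b where "a \<in> S" "b \<in> U - S" "(a, b) \<in> R \<or> (b, a) \<in> R"
      using cut_connectedE[OF R] by metis
    moreover from this have "a \<in> W" "b \<in> W" using S assms by auto
    ultimately show "\<exists>a\<in>S. \<exists>b\<in>U - S. (a, b) \<in> R \<inter> W \<times> W \<or> (b, a) \<in> R \<inter> W \<times> W" by blast
  qed
qed (auto intro: cut_connected_mono)

lemma cut_connected_insert:
  assumes "cut_connected R U" "u \<in> U" "(u, w) \<in> R \<or> (w, u) \<in> R"
  shows "cut_connected R (insert w U)"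
  unfolding cut_connected_def
proof (intro allI impI)
  fix S assume S: "S \<subseteq> insert w U \<and> S \<noteq> {} \<and> S \<noteq> insert w U"
  show "\<exists>a\<in>S. \<exists>b\<in>insert w U - S. (a, b) \<in> R \<or> (b, a) \<in> R"
  proof (cases "S - {w} = {} \<or> S - {w} = U")
    case True
    then consider "S = {w}" "w \<notin> U" | "S = {w}" "w \<in> U" | "S = U" "w \<notin> U" using S by blast
    then show ?thesis
    proof cases
      case 2
      then have "{w} \<subseteq> U" "{w} \<noteq> {}" "{w} \<noteq> U" using S by auto
      from cut_connectedE[OF assms(1) this] show ?thesis using 2 by (metis Diff_iff insertI2)
    qed (use assms in auto)
  next
    case False
    then have "S - {w} \<subseteq> U" "S - {w} \<noteq> {}" "S - {w} \<noteq> U" using S by auto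
    then obtain a b where ab: "a \<in> S - {w}" "b \<in> U - (S - {w})" "(a, b) \<in> R \<or> (b, a) \<in> R"
      by (rule cut_connectedE[OF assms(1)])
    show ?thesis
    proof (cases "b \<in> S")
      case False
      then show ?thesis using ab by blast
    next
      \<comment> \<open>The crossing arc of \<open>U\<close> may end in \<open>w\<close>, which is
        already in \<open>S\<close>. Then either \<open>u\<close> is outside \<open>S\<close> and
        its arc with \<open>w\<close> crosses, or \<open>S\<close> is itself a proper part of
        \<open>U\<close>.\<close>
      case True
      then have "b = w" using ab by auto
      show ?thesis
      proof (cases "u \<in> S")
        case False
        then show ?thesis using True \<open>b = w\<close> assms(2,3) by blast
      next
        case u: True
        have "w \<in> U" using ab \<open>b = w\<close> by auto
        then have "S \<subseteq> U" "S \<noteq> {}" "S \<noteq> U" using S by auto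
        from cut_connectedE[OF assms(1) this] show ?thesis by blast
      qed
    qed
  qed
qed

lemma outdeg_on_Restr:
  assumes "U \<subseteq> W" "u \<in> W"
  shows "outdeg_on (R \<inter> W \<times> W) U u = outdeg_on R U u"
  unfolding outdeg_on_def using assms by (intro arg_cong[where f = card]) auto

text \<open>A path in the symmetric closure that starts in \<open>S\<close> and ends outside must
  cross the cut. Conversely, the vertices reachable from \<open>u\<close> would form a cut that no
  arc crosses.\<close>

lemma (in wf_digraph) connected_iff_cut_connected:
  "Digraph_Component.connected G \<longleftrightarrow> verts G \<noteq> {} \<and> cut_connected (arcs_ends G) (verts G)"
proof -
  let ?E = "parcs (mk_symmetric G)"
  interpret S: pair_wf_digraph "mk_symmetric G" ..
  have E: "(u, v) \<in> ?E \<longleftrightarrow> (u, v) \<in> arcs_ends G \<or> (v, u) \<in> arcs_ends G" for u v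
    by (auto simp: parcs_mk_symmetric arcs_ends_conv)
  have conn: "Digraph_Component.connected G \<longleftrightarrow>
      verts G \<noteq> {} \<and> (\<forall>u\<in>verts G. \<forall>v\<in>verts G. (u, v) \<in> ?E\<^sup>*)"
    unfolding connected_def strongly_connected_def by (simp add: S.reachable_conv')
  show ?thesis
  proof
    assume c: "Digraph_Component.connected G"
    have "cut_connected (arcs_ends G) (verts G)"
      unfolding cut_connected_def
    proof (intro allI impI)
      fix S assume S: "S \<subseteq> verts G \<and> S \<noteq> {} \<and> S \<noteq> verts G"
      then obtain u w where uw: "u \<in> S" "w \<in> verts G" "w \<notin> S" by blast
      have "(u, w) \<in> ?E\<^sup>*" using c uw S unfolding conn by blast
      then have "\<exists>a\<in>S. \<exists>b. b \<notin> S \<and> (a, b) \<in> ?E"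
        using uw(1) uw(3) by (induction rule: converse_rtrancl_induct) auto
      then obtain a b where "a \<in> S" "b \<notin> S" "(a, b) \<in> ?E" by blast
      then show "\<exists>u\<in>S. \<exists>v\<in>verts G - S. u \<rightarrow>\<^bsub>G\<^esub> v \<or> v \<rightarrow>\<^bsub>G\<^esub> u"
        unfolding E using adj_in_verts by blast
    qed
    then show "verts G \<noteq> {} \<and> cut_connected (arcs_ends G) (verts G)" using c conn by blast
  next
    assume c: "verts G \<noteq> {} \<and> cut_connected (arcs_ends G) (verts G)"
    have "(u, v) \<in> ?E\<^sup>*" if "u \<in> verts G" "v \<in> verts G" for u v
    proof (rule ccontr)
      define S where "S = {w \<in> verts G. (u, w) \<in> ?E\<^sup>*}"
      assume "(u, v) \<notin> ?E\<^sup>*"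
      then have "S \<subseteq> verts G" "S \<noteq> {}" "S \<noteq> verts G" using that by (auto simp: S_def)
      then obtain a b where ab: "a \<in> S" "b \<in> verts G - S" "a \<rightarrow>\<^bsub>G\<^esub> b \<or> b \<rightarrow>\<^bsub>G\<^esub> a"
        by (rule cut_connectedE[OF conjunct2[OF c]])
      then have "(a, b) \<in> ?E" using E by blast
      moreover have "(u, a) \<in> ?E\<^sup>*" "(u, b) \<notin> ?E\<^sup>*" using ab by (auto simp: S_def)
      ultimately show False by (meson rtrancl.rtrancl_into_rtrancl)
    qed
    then show "Digraph_Component.connected G" using c unfolding conn by blast
  qed
qed

lemma (in wf_digraph) connected_induce_subgraph_iff:
  "Digraph_Component.connected (G \<restriction> U) \<longleftrightarrow> U \<noteq> {} \<and> cut_connected (arcs_ends G) U"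
  using wf_digraph.connected_iff_cut_connected[OF wellformed_induce_subgraph, of U]
  by (simp add: arcs_ends_induce_subgraph cut_connected_Restr)

lemma subgraph_cut_connected:
  assumes "subgraph T K" "Digraph_Component.connected T"
  shows "verts T \<noteq> {}" "cut_connected (arcs_ends K) (verts T)"
proof -
  have "wf_digraph T" using assms(1) by (simp add: subgraph_def)
  then have "verts T \<noteq> {} \<and> cut_connected (arcs_ends T) (verts T)"
    using assms(2) wf_digraph.connected_iff_cut_connected by blast
  then show "verts T \<noteq> {}" "cut_connected (arcs_ends K) (verts T)"
    using cut_connected_mono[OF _ arcs_ends_mono[OF assms(1)]] by auto
qed

text \<open>Maximality is applied to two larger connected subgraphs: the one induced on the same
  vertices, which shows that a component is induced, and the one with an adjacent vertex added,
  which shows that it is closed.\<close>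

lemma (in wf_digraph) weak_componentD:
  assumes "weak_component G T"
  shows "verts T \<subseteq> verts G" "verts T \<noteq> {}" "cut_connected (arcs_ends G) (verts T)"
    and "T = G \<restriction> verts T"
    and "\<And>u v. u \<in> verts T \<Longrightarrow> v \<in> verts G \<Longrightarrow> u \<rightarrow>\<^bsub>G\<^esub> v \<or> v \<rightarrow>\<^bsub>G\<^esub> u \<Longrightarrow> v \<in> verts T"
proof -
  have T: "subgraph T G" "Digraph_Component.connected T"
    and max: "\<And>H. subgraph T H \<Longrightarrow> subgraph H G \<Longrightarrow> Digraph_Component.connected H \<Longrightarrow> H = T"
    using assms unfolding weak_component_def max_subgraph_def by blast+
  show verts: "verts T \<subseteq> verts G" using T(1) by (rule subgraph_imp_subverts)
  note conn = subgraph_cut_connected[OF T]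
  show "verts T \<noteq> {}" "cut_connected (arcs_ends G) (verts T)" by (fact conn)+
  have sub: "subgraph T (G \<restriction> verts T)" using T(1) by (rule subgraph_induce_subgraphI2)
  have "Digraph_Component.connected (G \<restriction> verts T)"
    using conn by (simp add: connected_induce_subgraph_iff)
  then show "T = G \<restriction> verts T"
    by (rule max[OF sub induced_imp_subgraph[OF induced_induce[OF verts]], symmetric])
  fix u v assume uv: "u \<in> verts T" "v \<in> verts G" "u \<rightarrow>\<^bsub>G\<^esub> v \<or> v \<rightarrow>\<^bsub>G\<^esub> u"
  let ?H = "G \<restriction> insert v (verts T)"
  have "subgraph T ?H"
    using sub by (auto simp: subgraph_def compatible_def wellformed_induce_subgraph)
  moreover have "subgraph ?H G"
    using verts uv(2) by (intro induced_imp_subgraph induced_induce) auto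
  moreover have "Digraph_Component.connected ?H"
    using cut_connected_insert[OF conn(2) uv(1,3)] by (simp add: connected_induce_subgraph_iff)
  ultimately have "?H = T" by (rule max)
  then have "verts ?H = verts T" by (rule arg_cong)
  then show "v \<in> verts T" by auto
qed

text \<open>The component is induced by an inclusion-maximal connected vertex set containing
  \<open>u\<close>. A larger connected subgraph has the same vertices by this maximality, and then
  also the same arcs.\<close>

lemma (in wf_digraph) weak_component_exists:
  assumes "finite (verts G)" "u \<in> verts G"
  obtains T where "weak_component G T" "u \<in> verts T"
proof -
  define \<U> where "\<U> = {U. u \<in> U \<and> U \<subseteq> verts G \<and> cut_connected (arcs_ends G) U}"
  have "finite \<U>"
    using assms(1) by (auto simp: \<U>_def intro: finite_subset[of _ "Pow (verts G)"])
  moreover have "{u} \<in> \<U>" using assms(2) by (auto simp: \<U>_def cut_connected_def)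
  ultimately obtain U where "U \<in> \<U>" and max: "\<And>W. W \<in> \<U> \<Longrightarrow> U \<subseteq> W \<Longrightarrow> U = W"
    using finite_has_maximal[of \<U>] by (metis empty_iff)
  then have U: "u \<in> U" "U \<subseteq> verts G" "cut_connected (arcs_ends G) U" by (auto simp: \<U>_def)
  have "weak_component G (G \<restriction> U)"
    unfolding weak_component_def max_subgraph_def
  proof (intro conjI allI impI)
    show "subgraph (G \<restriction> U) G" using U by (intro induced_imp_subgraph induced_induce) auto
    show "Digraph_Component.connected (G \<restriction> U)"
      using U by (auto simp: connected_induce_subgraph_iff)
    fix H assume "H \<noteq> G \<restriction> U \<and> subgraph (G \<restriction> U) H"
    then have H: "H \<noteq> G \<restriction> U" "subgraph (G \<restriction> U) H" by auto
    show "\<not> (subgraph H G \<and> Digraph_Component.connected H)"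
    proof
      assume H': "subgraph H G \<and> Digraph_Component.connected H"
      have "U \<subseteq> verts H" using subgraph_imp_subverts[OF H(2)] by simp
      moreover have "verts H \<in> \<U>"
        using subgraph_cut_connected(2)[of H G] H' subgraph_imp_subverts[of H G] calculation U(1)
        unfolding \<U>_def by blast
      ultimately have "verts H = U" using max by blast
      moreover have "arcs H = arcs (G \<restriction> U)"
        using H' H(2) calculation by (fastforce simp: subgraph_def compatible_def wf_digraph_def)
      ultimately have "H = G \<restriction> U"
        using H(2) by (intro pre_digraph.equality) (auto simp: subgraph_def compatible_def)
      then show False using H(1) by simp
    qed
  qed
  then show thesis using that[of "G \<restriction> U"] U by auto
qed

text \<open>After its first entry, \<open>awalk_verts u p\<close> lists the heads of the arcs, so
  distinctness of the inner vertices is distinctness of the heads. The index modulo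
  \<open>length p\<close> includes the closing step from the last arc to the first.\<close>

lemma (in wf_digraph) cycleD:
  assumes "cycle p"
  shows "p \<noteq> []" "set p \<subseteq> arcs G" "distinct (map (head G) p)"
    and "\<And>i. i < length p \<Longrightarrow> head G (p ! i) = tail G (p ! (Suc i mod length p))"
proof -
  obtain u where u: "awalk u p u" "distinct (tl (awalk_verts u p))" and ne: "p \<noteq> []"
    using assms by (auto simp: cycle_def)
  then have cas: "cas u p u" by (simp add: awalk_def)
  show "p \<noteq> []" "set p \<subseteq> arcs G" using ne u(1) by (auto simp: awalk_def)
  show "distinct (map (head G) p)" using u(2) awalk_verts_conv'[OF cas] ne by simp
  fix i assume i: "i < length p"
  have "awalk_verts u p ! Suc i = head G (p ! i)"
    using awalk_verts_conv'[OF cas] i ne by simp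
  moreover have "awalk_verts u p ! Suc i = tail G (p ! (Suc i mod length p))"
  proof (cases "Suc i = length p")
    case True
    have "awalk_verts u p ! length p = last (awalk_verts u p)"
      by (simp add: last_conv_nth length_awalk_verts)
    also have "\<dots> = tail G (hd p)"
      using awlast_if_cas[OF cas] awhd_if_cas[OF cas] awalk_verts_conv'[OF cas] ne by simp
    finally show ?thesis using True ne by (simp add: hd_conv_nth)
  next
    case False
    then have "Suc i < length p" using i by simp
    then show ?thesis using awalk_verts_conv[of u p] ne by (simp add: nth_append)
  qed
  ultimately show "head G (p ! i) = tail G (p ! (Suc i mod length p))" by simp
qed

text \<open>The heads along a cycle of length at least 3 in the symmetric closure are distinct and
  cyclically adjacent in \<open>R\<close>, which \<open>hanging_no_undirected_cycle\<close>
  excludes.\<close>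

lemma underlying_treeI_hanging:
  assumes V: "finite V" "cut_connected R V" and H: "hanging R V H" "H \<subseteq> V" "H \<noteq> {}"
    and T: "wf_digraph T" "Digraph_Component.connected T" "verts T \<subseteq> V - H" "arcs_ends T \<subseteq> R"
  shows "underlying_tree T"
  unfolding underlying_tree_def
proof (intro conjI notI)
  interpret T: wf_digraph T by fact
  interpret S: pair_wf_digraph "mk_symmetric T" ..
  let ?S = "with_proj (mk_symmetric T)"
  assume "\<exists>p. pre_digraph.cycle ?S p \<and> 3 \<le> length p"
  then obtain p where p: "pre_digraph.cycle ?S p" and len: "3 \<le> length p" by blast
  define c where "c i = snd (p ! i)" for i
  note cyc = S.cycleD[OF p]
  have arc: "p ! i \<in> parcs (mk_symmetric T)" if "i < length p" for i
    using subsetD[OF cyc(2) nth_mem[OF that]] by simp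
  have E: "(u, v) \<in> R \<or> (v, u) \<in> R" "u \<in> verts T" "v \<in> verts T"
    if "(u, v) \<in> parcs (mk_symmetric T)" for u v
    using that T(4) T.adj_in_verts by (auto simp: parcs_mk_symmetric arcs_ends_conv)
  have next_arc: "p ! (Suc i mod length p) = (c i, c (Suc i mod length p))" if "i < length p" for i
    using cyc(4)[OF that] by (auto simp: c_def prod_eq_iff)
  have lt: "Suc i mod length p < length p" for i using len by (intro mod_less_divisor) auto
  show False
  proof (rule hanging_no_undirected_cycle[OF V H len])
    show "inj_on c {..<length p}"
      using cyc(3) by (auto simp: inj_on_def c_def distinct_conv_nth)
    fix i assume i: "i < length p"
    then have "(c i, c (Suc i mod length p)) \<in> parcs (mk_symmetric T)"
      using arc[OF lt, of i] next_arc[OF i] by simp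
    from E[OF this] show "c i \<in> V - H"
      "(c i, c (Suc i mod length p)) \<in> R \<or> (c (Suc i mod length p), c i) \<in> R"
      using T(3) by auto
  qed
qed fact

text \<open>The bridge between the description by components and the local conditions:
  \<open>hangingI_components\<close> gives one direction, \<open>hanging_component_root\<close> and
  \<open>underlying_treeI_hanging\<close> the other.\<close>

lemma (in digraph) core_with_in_trees_iff_hanging:
  assumes conn: "Digraph_Component.connected G" and H: "induced_subgraph H G" "verts H \<noteq> {}"
  shows "core_with_in_trees G H \<longleftrightarrow> hanging (arcs_ends G) (verts G) (verts H)"
proof -
  let ?R = "arcs_ends G" and ?V = "verts G" and ?K = "delete_verts G (verts H)"
  have V: "finite ?V" "cut_connected ?R ?V"
    using conn connected_iff_cut_connected by auto
  have HV: "verts H \<subseteq> ?V" using H(1) by (intro subgraph_imp_subverts induced_imp_subgraph)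
  have K: "verts ?K = ?V - verts H" "arcs_ends ?K = ?R \<inter> (?V - verts H) \<times> (?V - verts H)"
    by (simp_all add: delete_verts_def arcs_ends_induce_subgraph)
  interpret K: digraph ?K
    unfolding delete_verts_def by (intro digraphI_induced induced_induce) auto
  \<comment> \<open>A component avoids \<open>verts H\<close>, so its arcs and outdegrees in
    \<open>?K\<close> can be expressed through the arcs of \<open>G\<close> itself.\<close>
  have comp: "wf_digraph T" "Digraph_Component.connected T" "verts T \<subseteq> ?V - verts H"
      "verts T \<noteq> {}" "cut_connected ?R (verts T)" "arcs_ends T \<subseteq> ?R"
      "\<And>u. u \<in> verts T \<Longrightarrow> out_degree T u = outdeg_on ?R (verts T) u"
      "\<And>u v. u \<in> verts T \<Longrightarrow> v \<in> ?V - verts H \<Longrightarrow> (u, v) \<in> ?R \<or> (v, u) \<in> ?R \<Longrightarrow> v \<in> verts T"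
    if "weak_component ?K T" for T
  proof -
    note c = K.weak_componentD[OF that]
    show sub: "verts T \<subseteq> ?V - verts H" using c(1) K(1) by simp
    show "verts T \<noteq> {}" by (fact c)
    show "cut_connected ?R (verts T)"
      using c(3) unfolding K(2) cut_connected_Restr[OF sub] .
    have "induced_subgraph T ?K" using K.induced_induce[OF c(1)] c(4) by simp
    then interpret T: digraph T by (rule K.digraphI_induced)
    show "wf_digraph T" by (rule T.wf_digraph)
    show "Digraph_Component.connected T"
      using that by (simp add: weak_component_def pre_digraph.max_subgraph_def)
    have ends: "arcs_ends T = arcs_ends ?K \<inter> verts T \<times> verts T"
      using arcs_ends_induce_subgraph[of ?K "verts T"] c(4) by simp
    then show "arcs_ends T \<subseteq> ?R" using K(2) by blast
    have "arcs_ends T = ?R \<inter> verts T \<times> verts T" using ends K(2) sub by blast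
    then show "out_degree T u = outdeg_on ?R (verts T) u" if "u \<in> verts T" for u
      using T.out_degree_eq_outdeg_on[of u] outdeg_on_Restr[of "verts T" "verts T" u ?R] that by simp
    show "v \<in> verts T" if "u \<in> verts T" "v \<in> ?V - verts H" "(u, v) \<in> ?R \<or> (v, u) \<in> ?R" for u v
      using c(5)[of u v] that sub unfolding K by blast
  qed
  show ?thesis
  proof
    assume core: "core_with_in_trees G H"
    show "hanging ?R ?V (verts H)"
    proof (rule hangingI_components[OF V(1) HV])
      fix u assume "u \<in> ?V - verts H"
      then obtain T where T: "weak_component ?K T" "u \<in> verts T"
        using K.weak_component_exists[of u] V(1) K(1) by auto
      note c = comp[OF T(1)]
      from core T(1) obtain x where x: "in_tree T" "in_tree_root T x"
        "\<exists>!y. y \<in> verts H \<and> x \<rightarrow>\<^bsub>G\<^esub> y"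
        "\<forall>u\<in>verts T. \<forall>y\<in>verts H. \<not> y \<rightarrow>\<^bsub>G\<^esub> u \<and> (u \<rightarrow>\<^bsub>G\<^esub> y \<longrightarrow> u = x)"
        unfolding core_with_in_trees_def by (elim conjE allE[of _ T] impE exE)
      have "\<forall>u\<in>verts T. outdeg_on ?R (verts T) u \<le> 1"
        using x(1) c(7) by (auto simp: in_tree_def)
      moreover have "{u \<in> verts T. outdeg_on ?R (verts T) u = 0} = {u \<in> verts T. out_degree T u = 0}"
        using c(7) by auto
      then have "{u \<in> verts T. outdeg_on ?R (verts T) u = 0} = {x}"
        using x(2) by (simp add: in_tree_root_def)
      moreover have "\<forall>u\<in>verts T. \<forall>v\<in>?V - verts H. (u, v) \<in> ?R \<longrightarrow> v \<in> verts T"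
        using c(8) by blast
      ultimately have "attached_component ?R ?V (verts H) (verts T) x"
        unfolding attached_component_def by (intro conjI c(3,5) x(3,4))
      then show "\<exists>U x. u \<in> U \<and> attached_component ?R ?V (verts H) U x" using T(2) by blast
    qed
  next
    assume hang: "hanging ?R ?V (verts H)"
    show "core_with_in_trees G H"
      unfolding core_with_in_trees_def
    proof (intro conjI allI impI)
      fix T assume T: "weak_component ?K T"
      note c = comp[OF T]
      have "outdeg_on ?R (verts T) u \<le> 1" if "u \<in> verts T" for u
      proof -
        have "outdeg_on ?R (verts T) u \<le> outdeg_on ?R ?V u" using c(3) V(1) by (intro outdeg_on_mono) auto
        also have "\<dots> = 1" using hang that c(3) by (auto simp: hanging_def)
        finally show ?thesis .
      qed
      then show "in_tree T"
        using underlying_treeI_hanging[OF V hang HV H(2) c(1,2,3,6)] c(7) by (simp add: in_tree_def)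
      have closed: "v \<in> verts T" if "u \<in> verts T" "v \<in> ?V - verts H" "u \<rightarrow>\<^bsub>G\<^esub> v" for u v
        using c(8) that by blast
      obtain x where x: "{u \<in> verts T. outdeg_on ?R (verts T) u = 0} = {x}"
        "\<exists>!y. y \<in> verts H \<and> x \<rightarrow>\<^bsub>G\<^esub> y" "\<forall>u\<in>verts T. \<forall>y\<in>verts H. u \<rightarrow>\<^bsub>G\<^esub> y \<longrightarrow> u = x"
        by (rule hanging_component_root[OF V hang HV H(2) c(3,4,5) closed])
      have "{u \<in> verts T. outdeg_on ?R (verts T) u = 0} = {u \<in> verts T. out_degree T u = 0}"
        using c(7) by auto
      then have "in_tree_root T x" using x(1) by (simp add: in_tree_root_def)
      moreover have "\<forall>u\<in>verts T. \<forall>y\<in>verts H. \<not> y \<rightarrow>\<^bsub>G\<^esub> u \<and> (u \<rightarrow>\<^bsub>G\<^esub> y \<longrightarrow> u = x)"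
        using hang c(3) x(3) unfolding hanging_def by blast
      ultimately show "\<exists>x. in_tree_root T x \<and> (\<exists>!y. y \<in> verts H \<and> x \<rightarrow>\<^bsub>G\<^esub> y) \<and>
          (\<forall>u\<in>verts T. \<forall>y\<in>verts H. \<not> y \<rightarrow>\<^bsub>G\<^esub> u \<and> (u \<rightarrow>\<^bsub>G\<^esub> y \<longrightarrow> u = x))"
        using x(2) by (intro exI[of _ x] conjI)
    qed (fact H)
  qed
qed

section \<open>Dicolouring-critical sets\<close>

definition acyclic_on :: "('a \<times> 'a) set \<Rightarrow> 'a set \<Rightarrow> bool" where
  "acyclic_on R A \<longleftrightarrow> acyclic (R \<inter> A \<times> A)"

text \<open>Colour classes may be empty, so this bounds the number of acyclic classes by
  \<open>k\<close> instead of fixing it.\<close>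

definition dicolourable :: "('a \<times> 'a) set \<Rightarrow> 'a set \<Rightarrow> nat \<Rightarrow> bool" where
  "dicolourable R S k \<longleftrightarrow> (\<exists>c. (\<forall>v\<in>S. c v < k) \<and> (\<forall>i<k. acyclic_on R {v \<in> S. c v = i}))"

lemma acyclic_on_insert_sink:
  assumes "acyclic_on R A" "\<And>w. w \<in> insert v A \<Longrightarrow> (v, w) \<notin> R"
  shows "acyclic_on R (insert v A)"
proof -
  let ?R = "R \<inter> insert v A \<times> insert v A"
  have sink: "(v, w) \<notin> ?R" for w using assms(2) by blast
  \<comment> \<open>A vertex without outgoing arcs can occur in a walk only as its end, so walks
    ending elsewhere stay inside \<open>A\<close>.\<close>
  have old: "(x, y) \<in> (R \<inter> A \<times> A)\<^sup>+" if "(x, y) \<in> ?R\<^sup>+" "y \<noteq> v" for x y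
    using that
  proof (induction rule: trancl_induct)
    case (base y)
    then show ?case using sink by blast
  next
    case (step y z)
    have "y \<noteq> v" using step.hyps(2) sink by blast
    moreover have "(y, z) \<in> R \<inter> A \<times> A" using step.hyps(2) step.prems \<open>y \<noteq> v\<close> by blast
    ultimately show ?case using step.IH by (meson trancl_into_trancl)
  qed
  have "(x, x) \<notin> ?R\<^sup>+" for x
  proof
    assume x: "(x, x) \<in> ?R\<^sup>+"
    then have "x \<noteq> v" using sink by (meson tranclD)
    then show False using old[OF x] assms(1) by (simp add: acyclic_on_def acyclic_def)
  qed
  then show ?thesis by (simp add: acyclic_on_def acyclic_def)
qed

lemma acyclic_on_converse: "acyclic_on (R\<inverse>) A \<longleftrightarrow> acyclic_on R A"
proof -
  have "R\<inverse> \<inter> A \<times> A = (R \<inter> A \<times> A)\<inverse>" by blast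
  then show ?thesis by (simp add: acyclic_on_def acyclic_converse)
qed

lemma acyclic_on_insert_source:
  assumes "acyclic_on R A" "\<And>w. w \<in> insert v A \<Longrightarrow> (w, v) \<notin> R"
  shows "acyclic_on R (insert v A)"
  using acyclic_on_insert_sink[of "R\<inverse>" A v] assms by (simp add: acyclic_on_converse)

lemma acyclic_on_pair:
  assumes "(a, a) \<notin> R" "(b, b) \<notin> R" "(a, b) \<notin> R \<or> (b, a) \<notin> R"
  shows "acyclic_on R {a, b}"
proof -
  have single: "acyclic_on R {x}" if "(x, x) \<notin> R" for x
  proof (rule acyclic_on_insert_sink)
    show "acyclic_on R {}" by (simp add: acyclic_on_def acyclic_def)
  qed (use that in auto)
  show ?thesis
  proof (cases "(a, b) \<in> R")
    case True
    have "acyclic_on R (insert b {a})"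
      using assms True by (intro acyclic_on_insert_sink single) auto
    then show ?thesis by (simp add: insert_commute)
  next
    case False
    then show ?thesis using assms by (intro acyclic_on_insert_sink single) auto
  qed
qed

lemma obtain_dicritical:
  assumes "finite V" "\<not> dicolourable R V k"
  obtains H where "H \<subseteq> V" "\<not> dicolourable R H k" "\<And>v. v \<in> H \<Longrightarrow> dicolourable R (H - {v}) k"
proof -
  define \<H> where "\<H> = {H. H \<subseteq> V \<and> \<not> dicolourable R H k}"
  have "finite \<H>" using assms(1) by (auto simp: \<H>_def intro: finite_subset[of _ "Pow V"])
  moreover have "V \<in> \<H>" using assms(2) by (simp add: \<H>_def)
  ultimately obtain H where H: "H \<in> \<H>" and min: "\<And>S. S \<in> \<H> \<Longrightarrow> S \<subseteq> H \<Longrightarrow> H = S"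
    using finite_has_minimal[of \<H>] by (metis empty_iff)
  have "dicolourable R (H - {v}) k" if "v \<in> H" for v
  proof (rule ccontr)
    assume "\<not> ?thesis"
    then have "H - {v} \<in> \<H>" using H by (auto simp: \<H>_def)
    then have "H = H - {v}" by (rule min) blast
    then show False using that by blast
  qed
  then show thesis using that H by (auto simp: \<H>_def)
qed

text \<open>With fewer than \<open>k\<close> out-neighbours, some colour is absent among them in a
  colouring of \<open>H - {v}\<close>. Given this colour, \<open>v\<close> is a sink in its class,
  so the class stays acyclic and \<open>H\<close> would be colourable.\<close>

lemma dicritical_outdeg_on_ge:
  assumes "finite H" "\<not> dicolourable R H k" "dicolourable R (H - {v}) k" "v \<in> H" "(v, v) \<notin> R"
  shows "k \<le> outdeg_on R H v"
proof (rule ccontr)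
  assume "\<not> k \<le> outdeg_on R H v"
  then have less: "outdeg_on R H v < k" by simp
  let ?N = "{w \<in> H. (v, w) \<in> R}"
  obtain c where c: "\<And>w. w \<in> H - {v} \<Longrightarrow> c w < k"
    "\<And>i. i < k \<Longrightarrow> acyclic_on R {w \<in> H - {v}. c w = i}"
    using assms(3) unfolding dicolourable_def by blast
  have "card (c ` ?N) < card {..<k}"
    using card_image_le[of ?N c] assms(1) less by (simp add: outdeg_on_def)
  then have "\<not> {..<k} \<subseteq> c ` ?N"
    using card_mono[of "c ` ?N" "{..<k}"] assms(1) by auto
  then obtain i where i: "i < k" "i \<notin> c ` ?N" by blast
  let ?c = "c(v := i)"
  have "acyclic_on R {w \<in> H. ?c w = j}" if "j < k" for j
  proof (cases "j = i")
    case True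
    have "acyclic_on R (insert v {w \<in> H - {v}. c w = i})"
    proof (rule acyclic_on_insert_sink)
      fix w assume "w \<in> insert v {w \<in> H - {v}. c w = i}"
      then show "(v, w) \<notin> R" using i(2) assms(5) by auto
    qed (rule c(2)[OF i(1)])
    also have "insert v {w \<in> H - {v}. c w = i} = {w \<in> H. ?c w = j}"
      using assms(4) True by auto
    finally show ?thesis .
  next
    case False
    then have "{w \<in> H. ?c w = j} = {w \<in> H - {v}. c w = j}" by auto
    then show ?thesis using c(2)[OF that] by simp
  qed
  moreover have "\<forall>w\<in>H. ?c w < k" using c(1) i(1) by auto
  ultimately have "dicolourable R H k" unfolding dicolourable_def by blast
  then show False using assms(2) by contradiction
qed

section \<open>Dicolourings and the dichromatic number\<close>

lemma acyclic_on_imp_acyclic_set: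
  assumes "wf_digraph G" "acyclic_on (arcs_ends G) S"
  shows "acyclic_set G S"
  unfolding acyclic_set_def
proof
  interpret G: wf_digraph G by fact
  interpret S: wf_digraph "G \<restriction> S" by (rule G.wellformed_induce_subgraph)
  assume "\<exists>p. pre_digraph.cycle (G \<restriction> S) p"
  then obtain u p where "S.awalk u p u" "p \<noteq> []" by (auto simp: S.cycle_def)
  then have "(u, u) \<in> (arcs_ends (G \<restriction> S))\<^sup>+" using S.reachable1_awalk by blast
  then show False
    using assms(2) by (simp add: arcs_ends_induce_subgraph acyclic_on_def acyclic_def)
qed

lemma dichromatic_number_le:
  assumes "partition_on (verts G) P" "\<And>S. S \<in> P \<Longrightarrow> acyclic_set G S"
  shows "dichromatic_number G \<le> card P"
  unfolding dichromatic_number_def using assms by (intro Least_le) auto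

lemma (in digraph) dicolourable_imp_dichromatic_number_le:
  assumes "dicolourable (arcs_ends G) (verts G) k"
  shows "dichromatic_number G \<le> k"
proof -
  let ?V = "verts G"
  obtain c where c: "\<And>v. v \<in> ?V \<Longrightarrow> c v < k" "\<And>i. i < k \<Longrightarrow> acyclic_on (arcs_ends G) {v \<in> ?V. c v = i}"
    using assms unfolding dicolourable_def by blast
  \<comment> \<open>Only colours that occur are taken, since the blocks of a partition must be
    nonempty.\<close>
  let ?P = "(\<lambda>i. {v \<in> ?V. c v = i}) ` c ` ?V"
  have "partition_on ?V ?P"
    by (rule partition_onI) (auto simp: disjnt_def)
  then have "dichromatic_number G \<le> card ?P"
    using c by (intro dichromatic_number_le acyclic_on_imp_acyclic_set wf_digraph) auto
  also have "\<dots> \<le> card (c ` ?V)" by (intro card_image_le) auto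
  also have "\<dots> \<le> card {..<k}" using c(1) by (intro card_mono) auto
  finally show ?thesis by simp
qed

lemma (in digraph) obtain_cycle_of_dichromatic_number:
  assumes "dichromatic_number G > 1" "verts G \<noteq> {}"
  obtains p where "cycle p"
proof -
  have "\<not> acyclic_set G (verts G)"
    using dichromatic_number_le[of G "{verts G}"] assms by (auto simp: partition_on_def)
  then obtain p where "pre_digraph.cycle (G \<restriction> verts G) p" by (auto simp: acyclic_set_def)
  then have "cycle p"
    using subgraph_cycle[OF induced_imp_subgraph[OF induced_induce]] by blast
  then show thesis by (rule that)
qed

section \<open>Energy estimates from outdegrees\<close>

lemma outdeg_on_less_card:
  assumes "finite S" "u \<in> S" "(u, u) \<notin> R"
  shows "outdeg_on R S u < card S"
  unfolding outdeg_on_def using assms by (intro psubset_card_mono) auto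

lemma complete_of_outdeg_on:
  assumes "finite S" "u \<in> S" "(u, u) \<notin> R" "card S - 1 \<le> outdeg_on R S u" "v \<in> S" "v \<noteq> u"
  shows "(u, v) \<in> R"
proof -
  have "{w \<in> S. (u, w) \<in> R} = S - {u}"
  proof (rule card_seteq)
    show "card (S - {u}) \<le> card {w \<in> S. (u, w) \<in> R}" using assms by (simp add: outdeg_on_def)
  qed (use assms in auto)
  then show ?thesis using assms(5,6) by blast
qed

lemma card_off_diagonal:
  "finite S \<Longrightarrow> card {(u, v). u \<in> S \<and> v \<in> S \<and> u \<noteq> v} = card S * (card S - 1)"
proof -
  assume "finite S"
  moreover have "{(u, v). u \<in> S \<and> v \<in> S \<and> u \<noteq> v} = (SIGMA u:S. S - {u})" by auto
  ultimately show ?thesis by (simp add: card_Diff_singleton)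
qed

text \<open>For \<open>r\<close> vertices the energy is
  \<open>r * (r - 1)^2 + r * (r - 1) = r^3 - r^2\<close>.\<close>

lemma energy_complete:
  assumes "finite S" "\<And>u v. u \<in> S \<Longrightarrow> v \<in> S \<Longrightarrow> (u, v) \<in> R \<longleftrightarrow> u \<noteq> v"
  shows "energy R S + card S ^ 2 = card S ^ 3"
proof -
  have "outdeg_on R S u = card S - 1" if "u \<in> S" for u
  proof -
    have "{v \<in> S. (u, v) \<in> R} = S - {u}" using assms(2) that by auto
    then show ?thesis using assms(1) that by (simp add: outdeg_on_def)
  qed
  moreover have "digons R S = {(u, v). u \<in> S \<and> v \<in> S \<and> u \<noteq> v}"
    using assms(2) by (auto simp: digons_def)
  ultimately have E: "energy R S = card S * (card S - 1)\<^sup>2 + card S * (card S - 1)"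
    using card_off_diagonal[OF assms(1)] by (simp add: energy_def)
  show ?thesis
  proof (cases "card S")
    case (Suc m)
    then show ?thesis unfolding E by (simp add: power2_eq_square power3_eq_cube algebra_simps)
  qed (simp add: E)
qed

text \<open>Inclusion-exclusion for the arcs and their converses: the intersection consists of the
  digons, and the union contains only off-diagonal pairs.\<close>

lemma card_digons_ge:
  assumes "finite S" "\<And>u. u \<in> S \<Longrightarrow> (u, u) \<notin> R"
  shows "2 * (\<Sum>u\<in>S. outdeg_on R S u) \<le> card (digons R S) + card S * (card S - 1)"
proof -
  let ?A = "R \<inter> S \<times> S"
  have fin: "finite ?A" "finite (?A\<inverse>)" using assms(1) by auto
  have "card ?A + card (?A\<inverse>) = card (?A \<union> ?A\<inverse>) + card (?A \<inter> ?A\<inverse>)"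
    using fin by (rule card_Un_Int)
  moreover have "?A \<inter> ?A\<inverse> = digons R S" by (auto simp: digons_def)
  moreover have "card (?A \<union> ?A\<inverse>) \<le> card {(u, v). u \<in> S \<and> v \<in> S \<and> u \<noteq> v}"
    using assms by (intro card_mono) (auto intro: finite_subset[of _ "S \<times> S"])
  ultimately show ?thesis
    using sum_outdeg_on[OF assms(1), of R] card_off_diagonal[OF assms(1)] by (simp add: card_inverse)
qed

lemma energy_ge_deg_bound:
  assumes "finite S" "\<And>u. u \<in> S \<Longrightarrow> k \<le> outdeg_on R S u"
  shows "card S * k\<^sup>2 + card (digons R S) \<le> energy R S"
    and "energy R S = card S * k\<^sup>2 \<Longrightarrow> digons R S = {} \<and> (\<forall>u\<in>S. outdeg_on R S u = k)"
proof -
  have le: "k\<^sup>2 \<le> (outdeg_on R S u)\<^sup>2" if "u \<in> S" for u using assms(2)[OF that] by (rule power_mono) simp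
  then have sum_le: "(\<Sum>u\<in>S. k\<^sup>2) \<le> (\<Sum>u\<in>S. (outdeg_on R S u)\<^sup>2)" by (intro sum_mono) auto
  then show "card S * k\<^sup>2 + card (digons R S) \<le> energy R S" by (simp add: energy_def)
  assume "energy R S = card S * k\<^sup>2"
  then have "(\<Sum>u\<in>S. k\<^sup>2) = (\<Sum>u\<in>S. (outdeg_on R S u)\<^sup>2)" and "card (digons R S) = 0"
    using sum_le by (simp_all add: energy_def)
  then have "k\<^sup>2 = (outdeg_on R S u)\<^sup>2" if "u \<in> S" for u
    using sum_mono_inv[of "\<lambda>_. k\<^sup>2" S "\<lambda>u. (outdeg_on R S u)\<^sup>2"] le that assms(1) by blast
  then have "\<forall>u\<in>S. outdeg_on R S u = k" by (auto simp: power2_eq_iff)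
  then show "digons R S = {} \<and> (\<forall>u\<in>S. outdeg_on R S u = k)"
    using \<open>card (digons R S) = 0\<close> finite_digons[OF assms(1), of R] by simp
qed

text \<open>One class is a vertex \<open>v\<close> with its two out-neighbours, the other the
  remaining two vertices. Without digons no arc returns to \<open>v\<close>, so \<open>v\<close> is
  a source of its class, and two vertices alone carry no cycle.\<close>

lemma dicolourable_five:
  assumes "card S = 5" "\<And>u. u \<in> S \<Longrightarrow> (u, u) \<notin> R" "digons R S = {}" "\<And>u. u \<in> S \<Longrightarrow> outdeg_on R S u = 2"
  shows "dicolourable R S 2"
proof -
  have fin: "finite S" using assms(1) card.infinite by fastforce
  obtain v where v: "v \<in> S" using assms(1) by fastforce
  let ?N = "{w \<in> S. (v, w) \<in> R}"
  have "card ?N = 2" using assms(4)[OF v] by (simp add: outdeg_on_def)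
  then obtain a b where ab: "?N = {a, b}" "a \<noteq> b" by (auto simp: card_2_iff)
  then have abS: "a \<in> S" "b \<in> S" "(v, a) \<in> R" "(v, b) \<in> R" by auto
  have va: "v \<noteq> a" "v \<noteq> b" using abS assms(2) v by auto
  have "card (S - {v, a, b}) = 2"
    using fin v abS va ab(2) assms(1) by (subst card_Diff_subset) auto
  then obtain c d where cd: "S - {v, a, b} = {c, d}" by (auto simp: card_2_iff)
  then have cdS: "c \<in> S" "d \<in> S" by auto
  have no_digon: "(x, y) \<notin> R \<or> (y, x) \<notin> R" if "x \<in> S" "y \<in> S" for x y
    using assms(3) that by (auto simp: digons_def)
  have "acyclic_on R {a, b}" "acyclic_on R {c, d}"
    using no_digon abS cdS assms(2) by (auto intro!: acyclic_on_pair)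
  moreover have "(w, v) \<notin> R" if "w \<in> insert v {a, b}" for w
    using that no_digon[OF v] abS assms(2)[OF v] by blast
  ultimately have acyc: "acyclic_on R {v, a, b}" "acyclic_on R {c, d}"
    by (auto intro: acyclic_on_insert_source)
  define f where "f w = (if w \<in> {v, a, b} then 0 else 1 :: nat)" for w
  have "{w \<in> S. f w = 0} = {v, a, b}" "{w \<in> S. f w = 1} = {c, d}"
    using v abS unfolding cd[symmetric] by (auto simp: f_def)
  then have "acyclic_on R {w \<in> S. f w = i}" if "i < 2" for i
    using that acyc by (auto simp: less_2_cases_iff)
  moreover have "f w < 2" for w by (simp add: f_def)
  ultimately show ?thesis unfolding dicolourable_def by blast
qed

text \<open>With \<open>r = s + 1\<close>, the bound is \<open>r\<^sup>2 (r - 1) + (card H - r)\<close> without subtraction.\<close>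

lemma dicritical_energy_ge:
  assumes fin: "finite H" and irrefl: "\<And>u. u \<in> H \<Longrightarrow> (u, u) \<notin> R"
    and nc: "\<not> dicolourable R H s" and deg: "\<And>u. u \<in> H \<Longrightarrow> s \<le> outdeg_on R H u" and s: "2 \<le> s"
  shows "s ^ 3 + 2 * s\<^sup>2 + card H \<le> energy R H + 1"
    and "energy R H + 1 = s ^ 3 + 2 * s\<^sup>2 + card H \<Longrightarrow> card H = s + 1"
proof -
  let ?h = "card H" and ?D = "card (digons R H)" and ?E = "energy R H"
  have "H \<noteq> {}" using nc by (auto simp: dicolourable_def acyclic_on_def acyclic_def)
  then obtain u where u: "u \<in> H" by blast
  have h: "s + 1 \<le> ?h" using deg[OF u] outdeg_on_less_card[OF fin u irrefl[OF u]] by simp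
  have E: "?h * s\<^sup>2 + ?D \<le> ?E" using energy_ge_deg_bound(1)[OF fin deg] .
  have "?h * s \<le> (\<Sum>u\<in>H. outdeg_on R H u)" using sum_mono[of H "\<lambda>_. s"] deg by fastforce
  then have D: "2 * (?h * s) \<le> ?D + ?h * (?h - 1)" using card_digons_ge[OF fin irrefl] by linarith
  have cases: "?h = s + 1 \<or> s ^ 3 + 2 * s\<^sup>2 + ?h < ?E + 1"
  proof -
    consider "?h = s + 1" | "?h = s + 2" | "s + 3 \<le> ?h" using h by linarith
    then show ?thesis
    proof cases
      case 2
      \<comment> \<open>The count forces at least \<open>(s + 2) * (s - 1)\<close> ordered digon
        pairs, which reduces the claim to \<open>s^2 > 3\<close>.\<close>
      have "2 * ((s + 2) * s) \<le> ?D + (s + 2) * (s + 1)" using D unfolding 2 by simp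
      moreover have "4 \<le> s * s" using mult_mono[OF s s] by simp
      ultimately have "s ^ 3 + 2 * s\<^sup>2 + ?h < ?E + 1"
        using E unfolding 2 by (simp add: power2_eq_square power3_eq_cube algebra_simps)
      then show ?thesis ..
    next
      case 3
      then obtain j where j: "?h = s + 3 + j" using le_Suc_ex by blast
      have s2: "s\<^sup>2 \<ge> 4" using power_mono[OF s, of 2] by simp
      \<comment> \<open>By the degrees alone it suffices that
        \<open>s + 2 + j < s^2 + j * s^2\<close>, which fails only for \<open>s = 2\<close>,
        \<open>j = 0\<close>. There the degree bound is 20, and energy exactly 20 would mean
        outdegrees 2 and no digons, hence a 2-colouring.\<close>
      show ?thesis
      proof (cases "s = 2 \<and> j = 0")
        case True
        then have "?h = 5" using j by simp
        have "?E \<noteq> ?h * s\<^sup>2"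
          using energy_ge_deg_bound(2)[OF fin deg] dicolourable_five[OF \<open>?h = 5\<close> irrefl] nc True by auto
        then have "?E > 20" using E True \<open>?h = 5\<close> by simp
        then show ?thesis using True \<open>?h = 5\<close> by simp
      next
        case False
        have "j \<le> j * s\<^sup>2" using s2 by simp
        have "s ^ 3 + 2 * s\<^sup>2 + ?h < ?h * s\<^sup>2 + 1"
        proof (cases "s = 2")
          case True
          then show ?thesis using False j by simp
        next
          case s3: False
          then have "s * s \<ge> 3 * s" using s by (intro mult_right_mono) auto
          moreover have "j \<le> j * (s * s)" using \<open>j \<le> j * s\<^sup>2\<close> by (simp add: power2_eq_square)
          ultimately have "Suc (Suc (j + s)) < s * s + j * (s * s)" using s3 s by linarith
          then show ?thesis unfolding j
            by (simp add: power2_eq_square power3_eq_cube algebra_simps)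
        qed
        then show ?thesis using E by simp
      qed
    qed simp
  qed
  have "s ^ 3 + 2 * s\<^sup>2 + ?h \<le> ?E + 1" if h: "?h = s + 1"
  proof -
    \<comment> \<open>For \<open>s + 1\<close> vertices the count makes every ordered pair of
      distinct vertices a digon.\<close>
    have "2 * ((s + 1) * s) \<le> ?D + (s + 1) * s" using D unfolding h by simp
    then show ?thesis
      using E unfolding h by (simp add: power2_eq_square power3_eq_cube algebra_simps)
  qed
  then show "s ^ 3 + 2 * s\<^sup>2 + ?h \<le> ?E + 1" using cases by linarith
  show "?h = s + 1" if "?E + 1 = s ^ 3 + 2 * s\<^sup>2 + ?h" using cases that by linarith
qed

section \<open>Cycles, complete digraphs and the extremal cases\<close>

lemma arcs_ends_induced_subgraph:
  assumes "induced_subgraph H G"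
  shows "arcs_ends H = arcs_ends G \<inter> verts H \<times> verts H"
  using assms by (auto simp: induced_subgraph_def subgraph_def compatible_def arcs_ends_conv)

lemma energy_Restr: "energy (R \<inter> S \<times> S) S = energy R S"
proof -
  have "digons (R \<inter> S \<times> S) S = digons R S" by (auto simp: digons_def)
  then show ?thesis by (simp add: energy_def outdeg_on_Restr)
qed

lemma energy_eq_card:
  assumes "\<And>u. u \<in> S \<Longrightarrow> outdeg_on R S u = 1" "digons R S = {}"
  shows "energy R S = card S"
  using assms by (simp add: energy_def)

lemma (in loopfree_digraph) no_loop_in_arcs_ends: "(u, u) \<notin> arcs_ends G"
  using adj_not_same by blast

text \<open>Each head is the tail of the cyclically next arc, so heads and tails fill the same set
  \<open>S\<close>. The heads are distinct, which gives the size of \<open>S\<close>, and comparison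
  of cardinalities makes \<open>tail G\<close> injective on the cycle.\<close>

lemma (in digraph) cycle_tails:
  assumes p: "cycle p"
  defines "S \<equiv> tail G ` set p"
  shows "S = head G ` set p" "card S = length p" "inj_on (tail G) (set p)"
    "S \<subseteq> verts G" "S \<noteq> {}" "\<And>u. u \<in> S \<Longrightarrow> 1 \<le> outdeg_on (arcs_ends G) S u"
proof -
  note c = cycleD[OF p]
  let ?n = "length p"
  have n: "?n > 0" using c(1) by simp
  show S: "S = head G ` set p"
  proof
    show "head G ` set p \<subseteq> S"
    proof
      fix x assume "x \<in> head G ` set p"
      then obtain i where "i < ?n" "x = head G (p ! i)" by (auto simp: in_set_conv_nth)
      then show "x \<in> S" using c(4) n by (auto simp: S_def)
    qed
    show "S \<subseteq> head G ` set p"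
    proof
      fix x assume "x \<in> S"
      then obtain j where j: "j < ?n" "x = tail G (p ! j)" by (auto simp: S_def in_set_conv_nth)
      define i where "i = (if j = 0 then ?n - 1 else j - 1)"
      have i: "i < ?n" "Suc i mod ?n = j" using j(1) by (auto simp: i_def)
      then show "x \<in> head G ` set p" using c(4)[OF i(1)] j(2) by (metis image_eqI nth_mem)
    qed
  qed
  have "card (head G ` set p) = ?n" using distinct_card[OF c(3)] by simp
  then show card: "card S = ?n" using S by simp
  have "card (set p) \<le> card S" using card card_length[of p] by simp
  then show "inj_on (tail G) (set p)"
    unfolding S_def by (intro eq_card_imp_inj_on antisym card_image_le) auto
  show "S \<subseteq> verts G" using c(2) by (auto simp: S_def)
  show "S \<noteq> {}" using c(1) by (simp add: S_def)
  fix u assume "u \<in> S"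
  then obtain e where e: "e \<in> set p" "u = tail G e" by (auto simp: S_def)
  have "finite S" by (simp add: S_def)
  moreover have "(u, head G e) \<in> arcs_ends G" "head G e \<in> S"
    using e c(2) S by (auto simp: arcs_ends_conv)
  ultimately have "outdeg_on (arcs_ends G) S u \<noteq> 0" using outdeg_on_eq_0_iff[of S "arcs_ends G" u] by blast
  then show "1 \<le> outdeg_on (arcs_ends G) S u" by simp
qed

text \<open>An arc inside the vertex set shares its tail with an arc of the cycle. Outdegree one
  makes the heads agree, and without multiple arcs the two coincide, so there are no chords.\<close>

lemma (in digraph) directed_cycle_induced:
  assumes p: "cycle p" and deg: "\<And>u. u \<in> tail G ` set p \<Longrightarrow> outdeg_on (arcs_ends G) (tail G ` set p) u = 1"
  shows "directed_cycle (length p) (G \<restriction> tail G ` set p)"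
proof -
  let ?S = "tail G ` set p"
  let ?C = "G \<restriction> ?S"
  note c = cycleD[OF p] and S = cycle_tails[OF p]
  have sub: "set p \<subseteq> arcs ?C"
  proof
    fix e assume e: "e \<in> set p"
    then have "head G e \<in> ?S" unfolding S(1) by (rule imageI)
    then show "e \<in> arcs ?C" using e c(2) by auto
  qed
  have "arcs ?C \<subseteq> set p"
  proof
    fix e assume e: "e \<in> arcs ?C"
    then obtain e' where e': "e' \<in> set p" "tail G e' = tail G e" by auto
    have "head G e = head G e'"
    proof (rule outdeg_on_eq_1_unique[OF deg])
      show "(tail G e, head G e) \<in> arcs_ends G" "(tail G e, head G e') \<in> arcs_ends G"
        using e e' c(2) by (auto simp: arcs_ends_conv intro!: rev_image_eqI[of e'])
      show "head G e' \<in> ?S" using e' S(1) by blast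
    qed (use e in auto)
    then have "e = e'" using e e' c(2) by (intro no_multi_arcs) (auto simp: arc_to_ends_def)
    then show "e \<in> set p" using e' by simp
  qed
  moreover have "pre_digraph.cycle ?C p"
  proof -
    obtain u where u: "awalk u p u" "distinct (tl (awalk_verts u p))" "p \<noteq> []"
      using p by (auto simp: cycle_def)
    have "u \<in> ?S" using u(1,3) by (cases p) (auto simp: awalk_def)
    then have "pre_digraph.awalk ?C u p u"
      using u(1) sub compatible_cas[OF compatible_induce_subgraph, of G ?S]
      by (simp add: pre_digraph.awalk_def)
    then show ?thesis
      using u compatible_awalk_verts[OF compatible_induce_subgraph, of G ?S]
      unfolding pre_digraph.cycle_def by auto
  qed
  moreover have "digraph ?C" using S(4) by (intro digraphI_induced induced_induce)
  ultimately show ?thesis using sub unfolding directed_cycle_def by auto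
qed

text \<open>There are at most \<open>l\<close> arcs and each of the \<open>l\<close> vertices has
  positive outdegree, so all outdegrees are one. In a digon, two steps along the cycle would lead
  back to the start, impossible for \<open>l\<close> at least 3.\<close>

lemma energy_directed_cycle:
  assumes "directed_cycle l C" "3 \<le> l"
  shows "card (verts C) = l" "energy (arcs_ends C) (verts C) = l"
proof -
  interpret digraph C using assms(1) by (simp add: directed_cycle_def)
  obtain p where p: "cycle p" "length p = l" "arcs C = set p" "verts C = tail C ` set p"
    using assms(1) by (auto simp: directed_cycle_def)
  note c = cycleD[OF p(1)] and S = cycle_tails[OF p(1), folded p(4)]
  let ?R = "arcs_ends C" and ?V = "verts C"
  show card: "card ?V = l" using S(2) p(2) by simp
  have "(\<Sum>u\<in>?V. outdeg_on ?R ?V u) = card (?R \<inter> ?V \<times> ?V)" by (simp add: sum_outdeg_on)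
  also have "\<dots> \<le> card ?R" by (intro card_mono) (auto simp: arcs_ends_def)
  also have "\<dots> \<le> card (set p)" unfolding arcs_ends_def p(3) by (intro card_image_le) simp
  also have "\<dots> \<le> (\<Sum>u\<in>?V. 1)" using card card_length[of p] p(2) by simp
  finally have "(\<Sum>u\<in>?V. outdeg_on ?R ?V u) \<le> (\<Sum>u\<in>?V. 1)" .
  moreover have "(\<Sum>u\<in>?V. 1) \<le> (\<Sum>u\<in>?V. outdeg_on ?R ?V u)" by (intro sum_mono S(6))
  ultimately have "(\<Sum>u\<in>?V. 1) = (\<Sum>u\<in>?V. outdeg_on ?R ?V u)" by simp
  then have deg: "outdeg_on ?R ?V u = 1" if "u \<in> ?V" for u
    using sum_mono_inv[of "\<lambda>_. 1" ?V "outdeg_on ?R ?V"] S(6) that by (metis finite_verts)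
  have "digons ?R ?V = {}"
  proof (rule equals0I)
    fix x assume "x \<in> digons ?R ?V"
    then obtain u v where "(u, v) \<in> ?R" "(v, u) \<in> ?R" by (auto simp: digons_def)
    then obtain e e' where e: "e \<in> set p" "e' \<in> set p" "head C e = tail C e'" "head C e' = tail C e"
      using p(3) by (auto simp: arcs_ends_conv)
    \<comment> \<open>Tails are injective on the cycle, so the arc starting at the head of the
      \<open>i\<close>-th arc is the cyclically next one.\<close>
    have succ: "Suc i mod l = j" if "head C (p ! i) = tail C (p ! j)" "i < l" "j < l" for i j
    proof -
      have lt: "Suc i mod l < l" using assms(2) by simp
      have "tail C (p ! (Suc i mod l)) = tail C (p ! j)" using c(4)[of i] that p(2) by simp
      then have "p ! (Suc i mod l) = p ! j"
        using lt that(3) by (intro inj_onD[OF S(3)] nth_mem) (simp_all add: p(2))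
      moreover have "distinct p" using c(3) by (simp add: distinct_map)
      ultimately show ?thesis using lt[folded p(2)] that(3)[folded p(2)] p(2) nth_eq_iff_index_eq by metis
    qed
    obtain i j where "i < l" "j < l" "e = p ! i" "e' = p ! j"
      using e(1,2) p(2) by (metis in_set_conv_nth)
    then have "Suc i mod l = j" "Suc j mod l = i" using succ e(3,4) by auto
    then show False using assms(2) \<open>i < l\<close> \<open>j < l\<close> by (auto simp: mod_Suc split: if_splits)
  qed
  then show "energy ?R ?V = l" using deg card by (simp add: energy_eq_card)
qed

lemma complete_digraph_induced:
  assumes "digraph G" "S \<subseteq> verts G" "\<And>u v. u \<in> S \<Longrightarrow> v \<in> S \<Longrightarrow> (u, v) \<in> arcs_ends G \<longleftrightarrow> u \<noteq> v"
  shows "complete_digraph (card S) (G \<restriction> S)"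
proof -
  interpret digraph G by fact
  interpret S: digraph "G \<restriction> S" using assms(2) by (intro digraphI_induced induced_induce)
  have ends: "arcs_ends (G \<restriction> S) = {(u, v). (u, v) \<in> S \<times> S \<and> u \<noteq> v}"
    using assms(3) by (auto simp: arcs_ends_induce_subgraph)
  then have "symmetric (G \<restriction> S)" by (auto simp: symmetric_def intro: symI)
  then have "graph (G \<restriction> S)" by (rule S.graphI)
  then show ?thesis using ends by (simp add: complete_digraph_def)
qed

section \<open>Energy bounds and equality for weakly connected digraphs\<close>

context digraph
begin

lemma energy_core_with_in_trees:
  assumes "Digraph_Component.connected G" "core_with_in_trees G H" "verts H \<noteq> {}"
  shows "energy (arcs_ends G) (verts G) = energy (arcs_ends H) (verts H) + (card (verts G) - card (verts H))"
proof -
  have ind: "induced_subgraph H G" using assms(2) by (simp add: core_with_in_trees_def)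
  have sub: "verts H \<subseteq> verts G" using ind by (intro subgraph_imp_subverts induced_imp_subgraph)
  have "hanging (arcs_ends G) (verts G) (verts H)"
    using core_with_in_trees_iff_hanging[OF assms(1) ind assms(3)] assms(2) by simp
  then show ?thesis
    using energy_hanging[OF finite_verts sub] sub finite_subset[OF sub finite_verts]
    by (simp add: arcs_ends_induced_subgraph[OF ind] energy_Restr card_Diff_subset)
qed

lemma core_with_in_trees_induced:
  assumes "Digraph_Component.connected G" "S \<subseteq> verts G" "S \<noteq> {}" "hanging (arcs_ends G) (verts G) S"
  shows "core_with_in_trees G (G \<restriction> S)"
  using core_with_in_trees_iff_hanging[OF assms(1) induced_induce[OF assms(2)]] assms by simp

text \<open>Without loops a cycle has at least two vertices, so it covers the whole digraph, which
  is then complete with energy \<open>2^3 - 2^2\<close>. Hence in order two both sides of the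
  equality statement always hold.\<close>

lemma energy_order_2:
  assumes "Digraph_Component.connected G" "card (verts G) = 2" "cycle p"
  shows "energy (arcs_ends G) (verts G) = 4" "directed_cycle 2 G"
proof -
  let ?R = "arcs_ends G" and ?S = "tail G ` set p"
  note S = cycle_tails[OF assms(3)]
  have less: "outdeg_on ?R ?S u < card ?S" if "u \<in> ?S" for u
    using outdeg_on_less_card[OF _ that no_loop_in_arcs_ends] by auto
  obtain u where u: "u \<in> ?S" using S(5) unfolding ex_in_conv[symmetric] by (rule exE)
  have "1 < card ?S" using S(6)[OF u] less[OF u] by linarith
  then have SV: "?S = verts G"
    using assms(2) by (intro card_seteq[OF finite_verts S(4)]) linarith
  then have len: "length p = 2" using S(2) assms(2) by simp
  have deg: "outdeg_on ?R ?S u = 1" if "u \<in> ?S" for u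
    using S(6)[OF that] less[OF that] SV assms(2) by simp
  have "(u, v) \<in> ?R \<longleftrightarrow> u \<noteq> v" if "u \<in> verts G" "v \<in> verts G" for u v
    using complete_of_outdeg_on[of "verts G" u ?R v] deg[of u] that SV assms(2) no_loop_in_arcs_ends
    by auto
  then show "energy ?R (verts G) = 4"
    using energy_complete[of "verts G" ?R] assms(2) by simp
  have "G \<restriction> verts G = G" by (intro pre_digraph.equality) auto
  then show "directed_cycle 2 G" using directed_cycle_induced[OF assms(3) deg] SV len by simp
qed

text \<open>The core is the vertex set of the given cycle, whose outdegrees are positive. Equality
  makes them all one and excludes digons, so the cycle is induced and has length at least 3.\<close>

lemma energy_ge_order:
  assumes "Digraph_Component.connected G" "cycle p"
  shows "card (verts G) \<le> energy (arcs_ends G) (verts G)"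
    and "energy (arcs_ends G) (verts G) = card (verts G) \<Longrightarrow>
      \<exists>l C. 3 \<le> l \<and> directed_cycle l C \<and> core_with_in_trees G C"
proof -
  let ?R = "arcs_ends G" and ?V = "verts G" and ?S = "tail G ` set p"
  note S = cycle_tails[OF assms(2)]
  have conn: "cut_connected ?R ?V" using assms(1) connected_iff_cut_connected by simp
  have fin: "finite ?S" by simp
  note core = energy_ge_core[OF finite_verts conn S(4,5,6)]
  have card: "card (?V - ?S) + card ?S = card ?V"
    using S(4) by (simp add: card_Diff_subset card_mono)
  have deg: "card ?S \<le> energy ?R ?S" using energy_ge_deg_bound(1)[OF fin S(6)] by simp
  then show "card ?V \<le> energy ?R ?V" using core(1) card by linarith
  assume eq: "energy ?R ?V = card ?V"
  have "hanging ?R ?V ?S" using core card deg eq by linarith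
  then have hang: "core_with_in_trees G (G \<restriction> ?S)"
    using assms(1) S(4,5) by (intro core_with_in_trees_induced)
  have "energy ?R ?S = card ?S * 1\<^sup>2" using core(1) card deg eq by simp
  then have deg1: "\<And>u. u \<in> ?S \<Longrightarrow> outdeg_on ?R ?S u = 1" and no_digon: "digons ?R ?S = {}"
    using energy_ge_deg_bound(2)[OF fin S(6)] by blast+
  have "3 \<le> card ?S"
  proof (rule ccontr)
    \<comment> \<open>In a core of at most two vertices, an out-neighbour \<open>v\<close> of
      \<open>u\<close> would send its own arc back to \<open>u\<close>.\<close>
    assume "\<not> 3 \<le> card ?S"
    moreover obtain u where u: "u \<in> ?S" using S(5) unfolding ex_in_conv[symmetric] by (rule exE)
    moreover obtain v where v: "v \<in> ?S" "(u, v) \<in> ?R" using deg1[OF u] by (rule outdeg_on_eq_1E)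
    ultimately have "(v, u) \<in> ?R"
      using complete_of_outdeg_on[of ?S v ?R u] deg1[OF v(1)] no_loop_in_arcs_ends by fastforce
    then show False using u v no_digon by (auto simp: digons_def)
  qed
  then show "\<exists>l C. 3 \<le> l \<and> directed_cycle l C \<and> core_with_in_trees G C"
    using directed_cycle_induced[OF assms(2) deg1] hang S(2) by auto
qed

text \<open>The core is a set critical for \<open>s = r - 1\<close> colours. In the equality case it
  has \<open>s + 1\<close> vertices, each of outdegree at least \<open>s\<close> inside it, so it is
  complete.\<close>

lemma energy_ge_complete:
  assumes conn: "Digraph_Component.connected G" and r: "dichromatic_number G = r" "3 \<le> r"
  shows "card (verts G) + r ^ 3 \<le> energy (arcs_ends G) (verts G) + r\<^sup>2 + r"
    and "energy (arcs_ends G) (verts G) + r\<^sup>2 + r = card (verts G) + r ^ 3 \<Longrightarrow>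
      \<exists>H. complete_digraph r H \<and> core_with_in_trees G H"
proof -
  let ?R = "arcs_ends G" and ?V = "verts G"
  obtain s where s: "r = s + 1" "2 \<le> s" using r(2) by (cases r) auto
  have "\<not> dicolourable ?R ?V s" using dicolourable_imp_dichromatic_number_le r(1) s(1) by fastforce
  then obtain H where H: "H \<subseteq> ?V" "\<not> dicolourable ?R H s" "\<And>v. v \<in> H \<Longrightarrow> dicolourable ?R (H - {v}) s"
    using obtain_dicritical[OF finite_verts] by metis
  have fin: "finite H" using H(1) by (rule finite_subset) simp
  have ne: "H \<noteq> {}" using H(2) by (auto simp: dicolourable_def acyclic_on_def acyclic_def)
  have deg: "s \<le> outdeg_on ?R H u" if "u \<in> H" for u
    using dicritical_outdeg_on_ge[OF fin H(2) H(3)[OF that] that no_loop_in_arcs_ends] .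
  have cut: "cut_connected ?R ?V" using conn connected_iff_cut_connected by simp
  have deg1: "1 \<le> outdeg_on ?R H u" if "u \<in> H" for u using deg[OF that] s(2) by simp
  note core = energy_ge_core[OF finite_verts cut H(1) ne deg1]
  note crit = dicritical_energy_ge[OF fin no_loop_in_arcs_ends H(2) deg s(2)]
  have card: "card (?V - H) + card H = card ?V"
    using H(1) fin by (simp add: card_Diff_subset card_mono)
  \<comment> \<open>This is \<open>r^3 - r^2 - r = s^3 + 2 * s^2 - 1\<close> in additive
    form.\<close>
  have target: "r ^ 3 + m + 1 = s ^ 3 + 2 * s\<^sup>2 + m + r\<^sup>2 + r" for m
    by (simp add: s(1) power2_eq_square power3_eq_cube algebra_simps)
  show "card ?V + r ^ 3 \<le> energy ?R ?V + r\<^sup>2 + r"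
    using target[of "card ?V"] crit(1) core(1) card by linarith
  assume eq: "energy ?R ?V + r\<^sup>2 + r = card ?V + r ^ 3"
  have "energy ?R ?V = energy ?R H + card (?V - H)" "energy ?R H + 1 = s ^ 3 + 2 * s\<^sup>2 + card H"
    using eq target[of "card ?V"] crit(1) core(1) card by linarith+
  then have hang: "hanging ?R ?V H" and h: "card H = s + 1" using core(2) crit(2) by auto
  have "(u, v) \<in> ?R \<longleftrightarrow> u \<noteq> v" if "u \<in> H" "v \<in> H" for u v
    using complete_of_outdeg_on[OF fin that(1) no_loop_in_arcs_ends, of v] deg[OF that(1)] h that
      no_loop_in_arcs_ends by auto
  then have "complete_digraph r (G \<restriction> H)"
    using complete_digraph_induced[OF digraph_axioms H(1)] h s(1) by simp
  then show "\<exists>H. complete_digraph r H \<and> core_with_in_trees G H"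
    using core_with_in_trees_induced[OF conn H(1) ne hang] by blast
qed

end

section \<open>Transfer of the energy bounds to the eigenvalue sum\<close>

theorem theorem2p10:
  fixes G :: "('a, 'b) pre_digraph" and vs :: "'a list" and n r :: nat
  assumes "digraph G" and "Digraph_Component.connected G"
    and "distinct vs" and "set vs = verts G"
    and "card (verts G) = n"
    and "dichromatic_number G = r"
  shows
    "(r = 2 \<longrightarrow>
        (n = 2 \<longrightarrow> LE G vs \<ge> 4 \<and> (LE G vs = 4 \<longleftrightarrow> directed_cycle 2 G)) \<and>
        (n \<ge> 3 \<longrightarrow> LE G vs \<ge> of_nat n \<and>
           (LE G vs = of_nat n \<longleftrightarrow>
              (\<exists>n' C. n' \<ge> 3 \<and> directed_cycle n' C \<and> core_with_in_trees G C)))) \<and>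
     (r \<ge> 3 \<longrightarrow>
        LE G vs \<ge> of_nat n + of_nat r ^ 3 - of_nat r ^ 2 - of_nat r \<and>
        (LE G vs = of_nat n + of_nat r ^ 3 - of_nat r ^ 2 - of_nat r \<longleftrightarrow>
           (\<exists>H. complete_digraph r H \<and> core_with_in_trees G H)))"
proof -
  interpret digraph G by fact
  define E where "E = energy (arcs_ends G) (verts G)"
  have LE: "LE G vs = of_nat E" unfolding E_def using assms(3,4) by (rule LE_eq_energy)
  have ne: "verts G \<noteq> {}" using assms(2) connected_iff_cut_connected by simp
  have cycle: "\<exists>p. cycle p" if "r = 2"
    using obtain_cycle_of_dichromatic_number[OF _ ne] assms(6) that by (metis one_less_numeral_iff semiring_norm(76))
  have sub: "verts H \<subseteq> verts G" if "core_with_in_trees G H" for H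
    using that by (intro subgraph_imp_subverts induced_imp_subgraph) (simp add: core_with_in_trees_def)
  have 1: "LE G vs \<ge> 4 \<and> (LE G vs = 4 \<longleftrightarrow> directed_cycle 2 G)" if "r = 2" "n = 2"
    using energy_order_2[OF assms(2)] cycle[OF that(1)] assms(5) that by (auto simp: LE E_def)
  have 2: "LE G vs \<ge> of_nat n \<and>
           (LE G vs = of_nat n \<longleftrightarrow>
              (\<exists>n' C. n' \<ge> 3 \<and> directed_cycle n' C \<and> core_with_in_trees G C))" if "r = 2"
  proof -
    obtain p where p: "cycle p" using cycle[OF \<open>r = 2\<close>] by blast
    note E = energy_ge_order[OF assms(2) p, folded E_def]
    have "E = n" if C: "3 \<le> l" "directed_cycle l C" "core_with_in_trees G C" for l C
    proof -
      note cyc = energy_directed_cycle[OF C(2,1)]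
      have "verts C \<noteq> {}" using cyc(1) C(1) by auto
      then show ?thesis
        using energy_core_with_in_trees[OF assms(2) C(3)] cyc card_mono[OF finite_verts sub[OF C(3)]]
          assms(5) by (simp add: E_def)
    qed
    then show ?thesis using E assms(5) by (auto simp: LE less_eq_complex_def)
  qed
  have 3: "LE G vs \<ge> of_nat n + of_nat r ^ 3 - of_nat r ^ 2 - of_nat r \<and>
        (LE G vs = of_nat n + of_nat r ^ 3 - of_nat r ^ 2 - of_nat r \<longleftrightarrow>
           (\<exists>H. complete_digraph r H \<and> core_with_in_trees G H))" if "3 \<le> r"
  proof -
    note ge = energy_ge_complete[OF assms(2,6) that, folded E_def]
    \<comment> \<open>\<open>k\<close> is the excess over the bound as a natural number: the complex
      inequality expresses that such a \<open>k\<close> exists, and equality means that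
      \<open>k\<close> is 0.\<close>
    obtain k where k: "E + r\<^sup>2 + r = n + r ^ 3 + k" using ge(1) assms(5) le_Suc_ex by metis
    have "(of_nat E :: complex) + of_nat r ^ 2 + of_nat r = of_nat n + of_nat r ^ 3 + of_nat k"
      using arg_cong[OF k, of "of_nat :: nat \<Rightarrow> complex"] by simp
    then have Ek: "LE G vs = of_nat n + of_nat r ^ 3 - of_nat r ^ 2 - of_nat r + of_nat k"
      by (simp add: LE algebra_simps)
    have "k = 0" if H: "complete_digraph r H" "core_with_in_trees G H" for H
    proof -
      have h: "card (verts H) = r" using H(1) by (simp add: complete_digraph_def)
      then have "verts H \<noteq> {}" using \<open>3 \<le> r\<close> by auto
      moreover have "energy (arcs_ends H) (verts H) + r\<^sup>2 = r ^ 3"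
        using energy_complete[of "verts H" "arcs_ends H"] H(1) finite_subset[OF sub[OF H(2)]] h
        by (auto simp: complete_digraph_def)
      ultimately show ?thesis
        using energy_core_with_in_trees[OF assms(2) H(2)] card_mono[OF finite_verts sub[OF H(2)]]
          assms(5) h k by (simp add: E_def)
    qed
    moreover have "\<exists>H. complete_digraph r H \<and> core_with_in_trees G H" if "k = 0"
      using ge(2) k that assms(5) by simp
    ultimately show ?thesis unfolding Ek by (auto simp: less_eq_complex_def)
  qed
  show ?thesis using 1 2 3 by blast
qed

end
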